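(* Let $\mathcal{H}$ be a real Hilbert space, let $A_1, A_2:\mathcal{H}\to 2^{\mathcal{H}}$ be maximally monotone, let $B:\mathcal{H}\to\mathcal{H}$ be monotone and $L$-Lipschitz continuous ($L>0$), let $C:\mathcal{H}\to\mathcal{H}$ be $\beta$-cocoercive ($\beta>0$), and assume that $\mathrm{zer}(A_1+A_2+B+C)\neq\emptyset$. Let $$a=\frac{17\beta L+10+\sqrt{(17\beta L+10)^2+144\beta^2L^2}}{6\beta L},\qquad \gamma\in\left(0,\frac{\beta}{5+(10+\frac{6}{a})\beta L}\right).$$ Let $z_0,y_0,y_{-1}\in\mathcal{H}$ and define for $n\ge0$ $$x_{n+1}=J_{\gamma A_1}z_n,\qquad y_{n+1}=J_{\gamma A_2}\big(2x_{n+1}-z_n-\gamma B(2y_n-y_{n-1})-\gamma Cy_n\big),\qquad z_{n+1}=z_n+y_{n+1}-x_{n+1}.$$ Then: (i) $\{z_n\}$ converges weakly to a point $\bar z\in\mathcal{H}$; (ii) $\{x_n\}$ and $\{y_n\}$ converge weakly to a point $\bar x\in\mathcal{H}$; (iii) $\bar x=J_{\gamma A_1}(\bar z)\in\mathrm{zer}(A_1+A_2+B+C)$.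
   Context: $J_{\gamma A}=(\mathrm{Id}+\gamma A)^{-1}$ denotes the resolvent of a maximally monotone operator $A$. $\mathrm{zer}(T)=\{x:0\in Tx\}$. $C$ is $\beta$-cocoercive if $\langle x-y,Cx-Cy\rangle\ge\beta\|Cx-Cy\|^2$ for all $x,y$. *)

theory Defs
  imports "HOL-Analysis.Analysis"
begin

definition monotone_op :: "('a::real_inner \<Rightarrow> 'a set) \<Rightarrow> bool" where
  "monotone_op A \<longleftrightarrow> (\<forall>x y u v. u \<in> A x \<longrightarrow> v \<in> A y \<longrightarrow> 0 \<le> (x - y) \<bullet> (u - v))"

definition maximal_monotone :: "('a::real_inner \<Rightarrow> 'a set) \<Rightarrow> bool" where
  "maximal_monotone A \<longleftrightarrow> monotone_op A \<and>
     (\<forall>x u. (\<forall>y v. v \<in> A y \<longrightarrow> 0 \<le> (x - y) \<bullet> (u - v)) \<longrightarrow> u \<in> A x)"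

definition monotone_fun :: "('a::real_inner \<Rightarrow> 'a) \<Rightarrow> bool" where
  "monotone_fun B \<longleftrightarrow> (\<forall>x y. 0 \<le> (x - y) \<bullet> (B x - B y))"

definition cocoercive :: "real \<Rightarrow> ('a::real_inner \<Rightarrow> 'a) \<Rightarrow> bool" where
  "cocoercive \<beta> C \<longleftrightarrow> (\<forall>x y. \<beta> * (norm (C x - C y))\<^sup>2 \<le> (x - y) \<bullet> (C x - C y))"

text \<open>Resolvent \<open>J_{\<gamma>A} = (Id + \<gamma>A)^{-1}\<close>: the (unique, for maximally monotone A and \<gamma> > 0) point x
  with \<open>z \<in> x + \<gamma> A x\<close>.\<close>
definition resolvent :: "real \<Rightarrow> ('a::real_inner \<Rightarrow> 'a set) \<Rightarrow> 'a \<Rightarrow> 'a" where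
  "resolvent \<gamma> A z = (THE x. \<exists>u \<in> A x. z = x + \<gamma> *\<^sub>R u)"

definition zer4 :: "('a::real_inner \<Rightarrow> 'a set) \<Rightarrow> ('a \<Rightarrow> 'a set) \<Rightarrow> ('a \<Rightarrow> 'a) \<Rightarrow> ('a \<Rightarrow> 'a) \<Rightarrow> 'a set" where
  "zer4 A1 A2 B C = {x. \<exists>u1 \<in> A1 x. \<exists>u2 \<in> A2 x. u1 + u2 + B x + C x = 0}"

definition weakly_converges :: "(nat \<Rightarrow> 'a::real_inner) \<Rightarrow> 'a \<Rightarrow> bool" where
  "weakly_converges s l \<longleftrightarrow> (\<forall>w. (\<lambda>n. s n \<bullet> w) \<longlonglongrightarrow> l \<bullet> w)"

end

theory Submission
  imports Defs "HOL-Library.Diagonal_Subsequence"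
begin

text \<open>
  If \<open>z\<^sup>* = x\<^sup>* + \<gamma> u\<^sub>1\<close> with \<open>u\<^sub>1 \<in> A\<^sub>1 x\<^sup>*\<close> belongs to a solution \<open>x\<^sup>*\<close>, monotonicity of \<open>A\<^sub>1\<close> and \<open>A\<^sub>2\<close> bounds
  \<open>\<parallel>z\<^sub>n\<^sub>+\<^sub>1 - z\<^sup>*\<parallel>\<^sup>2 - \<parallel>z\<^sub>n - z\<^sup>*\<parallel>\<^sup>2\<close> by \<open>- \<parallel>z\<^sub>n\<^sub>+\<^sub>1 - z\<^sub>n\<parallel>\<^sup>2\<close> plus error terms from \<open>B\<close> and \<open>C\<close>; the same argument for two
  consecutive iterates bounds \<open>\<parallel>\<Delta>z\<^sub>n\<^sub>+\<^sub>1\<parallel>\<^sup>2 - \<parallel>\<Delta>z\<^sub>n\<parallel>\<^sup>2\<close>. Adding twice the second estimate to the first, the error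
  of \<open>B\<close> becomes a telescoping term minus \<open>2\<gamma> (2 \<Delta>y\<^sub>n\<^sub>+\<^sub>1 - \<Delta>y\<^sub>n) \<bullet> (B w\<^sub>n - B w\<^sub>n\<^sub>-\<^sub>1)\<close> with
  \<open>w\<^sub>n - w\<^sub>n\<^sub>-\<^sub>1 = 2 \<Delta>y\<^sub>n - \<Delta>y\<^sub>n\<^sub>-\<^sub>1\<close>, so that all errors are multiples of \<open>\<parallel>2 \<Delta>y\<^sub>n\<^sub>+\<^sub>1 - \<Delta>y\<^sub>n\<parallel>\<^sup>2\<close>, and
  firm nonexpansiveness of the resolvent of \<open>A\<^sub>1\<close> lets the decrements absorb them once \<open>\<gamma>/(2\<beta>) + 2\<gamma>L < 1/5\<close>.
  Hence \<open>\<Delta>z\<^sub>n\<close> and \<open>\<Delta>y\<^sub>n\<close> tend to \<open>0\<close> and \<open>\<parallel>z\<^sub>n - z\<^sup>*\<parallel>\<close> converges for every such \<open>z\<^sup>*\<close>. Weak cluster points are of the form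
  \<open>z\<^sup>*\<close> by maximality, and Opial's argument shows that there is only one.
\<close>

section \<open>Maximal monotone operators and Minty's theorem\<close>

lemma monotone_opD:
  "monotone_op A \<Longrightarrow> u \<in> A x \<Longrightarrow> v \<in> A y \<Longrightarrow> 0 \<le> (x - y) \<bullet> (u - v)"
  unfolding monotone_op_def by blast

lemma maximal_monotone_imp_monotone: "maximal_monotone A \<Longrightarrow> monotone_op A"
  unfolding maximal_monotone_def by blast

lemma maximal_monotone_memI:
  assumes "maximal_monotone A" "\<And>y v. v \<in> A y \<Longrightarrow> 0 \<le> (x - y) \<bullet> (u - v)"
  shows "u \<in> A x"
  using assms unfolding maximal_monotone_def by blast

text \<open>Midpoints of almost minimal points show that the first components of a minimizing
  sequence are Cauchy; the first-order condition along segments gives the variational inequality.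
  With \<open>K\<close> an epigraph, \<open>p\<^sub>0\<close> is a proximal point at the origin.
  Minty's theorem, orthogonal projection and Riesz representation all rest on it.\<close>

lemma convex_quadratic_minimizer:
  fixes K :: "('b::{real_inner, complete_space} \<times> real) set"
  assumes clK: "closed K" and cvK: "convex K" and ne: "K \<noteq> {}"
    and bdd: "\<And>p t. (p, t) \<in> K \<Longrightarrow> c \<le> t + (norm p)\<^sup>2 / 2"
  obtains p\<^sub>0 t\<^sub>0 where "(p\<^sub>0, t\<^sub>0) \<in> K"
    "\<And>p t. (p, t) \<in> K \<Longrightarrow> t\<^sub>0 + (norm p\<^sub>0)\<^sup>2 \<le> t + p \<bullet> p\<^sub>0"
proof -
  define f :: "'b \<times> real \<Rightarrow> real" where "f q = snd q + (norm (fst q))\<^sup>2 / 2" for q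
  define m where "m = Inf (f ` K)"
  have bb: "bdd_below (f ` K)"
    using bdd by (auto simp: f_def intro!: bdd_belowI[of _ c])
  have m_le: "m \<le> f q" if "q \<in> K" for q
    unfolding m_def using bb that by (simp add: cINF_lower)
  have "\<exists>q. q \<in> K \<and> f q < m + 1 / real (Suc n)" for n
  proof -
    have "Inf (f ` K) < m + 1 / real (Suc n)" by (simp add: m_def)
    then show ?thesis using ne bb by (auto simp: cINF_less_iff)
  qed
  then obtain q where q: "\<And>n. q n \<in> K" "\<And>n. f (q n) < m + 1 / real (Suc n)" by metis
  \<comment> \<open>By the parallelogram law, \<open>f\<close> at the midpoint lies below the mean
    of \<open>f u\<close> and \<open>f v\<close> by
    \<open>(norm (fst u - fst v))\<^sup>2 / 8\<close>.\<close>
  have gap: "(norm (fst u - fst v))\<^sup>2 \<le> 4 * (f u - m + (f v - m))" if "u \<in> K" "v \<in> K" for u v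
  proof -
    have "(1/2) *\<^sub>R u + (1/2) *\<^sub>R v \<in> K"
      using convexD[OF cvK that, of "1/2" "1/2"] by simp
    then have "m \<le> f ((1/2) *\<^sub>R u + (1/2) *\<^sub>R v)" by (rule m_le)
    then show ?thesis
      by (simp add: f_def power2_norm_eq_inner inner_simps inner_commute) (simp add: field_simps)
  qed
  have "Cauchy (\<lambda>n. fst (q n))"
  proof (rule metric_CauchyI)
    fix e :: real assume e: "e > 0"
    obtain N where N: "1 / real (Suc N) < e\<^sup>2 / 8"
      using reals_Archimedean[of "e\<^sup>2 / 8"] e by (auto simp: inverse_eq_divide)
    have "dist (fst (q i)) (fst (q j)) < e" if ij: "i \<ge> N" "j \<ge> N" for i j
    proof -
      have s: "f (q k) - m < 1 / real (Suc N)" if "k \<ge> N" for k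
      proof -
        have "1 / real (Suc k) \<le> 1 / real (Suc N)" using that by (simp add: frac_le)
        then show ?thesis using q(2)[of k] by linarith
      qed
      have "f (q i) - m < e\<^sup>2 / 8" "f (q j) - m < e\<^sup>2 / 8"
        using s[OF ij(1)] s[OF ij(2)] N by (auto intro: less_trans)
      then have "(norm (fst (q i) - fst (q j)))\<^sup>2 < e\<^sup>2"
        using gap[OF q(1) q(1), of i j] by simp
      then show ?thesis using e by (simp add: dist_norm power2_less_imp_less)
    qed
    then show "\<exists>M. \<forall>i\<ge>M. \<forall>j\<ge>M. dist (fst (q i)) (fst (q j)) < e" by blast
  qed
  then obtain p\<^sub>0 where p0: "(\<lambda>n. fst (q n)) \<longlonglongrightarrow> p\<^sub>0"
    using Cauchy_convergent convergent_def by blast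
  \<comment> \<open>The heights \<open>snd (q n)\<close> converge because the values
    \<open>f (q n)\<close> and the norms do, and this is the limit they must have.\<close>
  define t\<^sub>0 where "t\<^sub>0 = m - (norm p\<^sub>0)\<^sup>2 / 2"
  have "(\<lambda>n. f (q n)) \<longlonglongrightarrow> m"
  proof (rule tendsto_sandwich[OF _ _ tendsto_const])
    show "(\<lambda>n. m + 1 / real (Suc n)) \<longlonglongrightarrow> m"
      using LIMSEQ_Suc[OF lim_1_over_n] tendsto_add[OF tendsto_const, of _ 0 sequentially m] by fastforce
  qed (use m_le q in \<open>auto intro!: always_eventually less_imp_le\<close>)
  then have "(\<lambda>n. f (q n) - (norm (fst (q n)))\<^sup>2 / 2) \<longlonglongrightarrow> t\<^sub>0"
    unfolding t\<^sub>0_def by (intro tendsto_intros p0) auto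
  then have "(\<lambda>n. snd (q n)) \<longlonglongrightarrow> t\<^sub>0" by (simp add: f_def)
  with p0 have "q \<longlonglongrightarrow> (p\<^sub>0, t\<^sub>0)" using tendsto_Pair by fastforce
  then have inK: "(p\<^sub>0, t\<^sub>0) \<in> K" using clK q(1) closed_sequentially by blast
  have "t\<^sub>0 + (norm p\<^sub>0)\<^sup>2 \<le> t + p \<bullet> p\<^sub>0" if "(p, t) \<in> K" for p t
  proof -
    define A where "A = t - t\<^sub>0 + p\<^sub>0 \<bullet> (p - p\<^sub>0)"
    have *: "0 \<le> A + s * ((norm (p - p\<^sub>0))\<^sup>2 / 2)" if s: "0 < s" "s \<le> 1" for s
    proof -
      have "(1 - s) *\<^sub>R (p\<^sub>0, t\<^sub>0) + s *\<^sub>R (p, t) \<in> K"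
        using convexD[OF cvK inK \<open>(p, t) \<in> K\<close>, of "1 - s" s] s by simp
      then have "m \<le> f ((1 - s) *\<^sub>R (p\<^sub>0, t\<^sub>0) + s *\<^sub>R (p, t))" by (rule m_le)
      moreover have "(norm ((1 - s) *\<^sub>R p\<^sub>0 + s *\<^sub>R p))\<^sup>2
          = (norm p\<^sub>0)\<^sup>2 + 2 * s * (p\<^sub>0 \<bullet> (p - p\<^sub>0)) + s * s * (norm (p - p\<^sub>0))\<^sup>2"
        unfolding power2_norm_eq_inner by (simp add: inner_simps inner_commute algebra_simps)
      ultimately have "0 \<le> s * (A + s * ((norm (p - p\<^sub>0))\<^sup>2 / 2))"
        by (simp add: f_def t\<^sub>0_def A_def) (simp add: field_simps)
      then show ?thesis using s by (simp add: zero_le_mult_iff)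
    qed
    have "((\<lambda>s. A + s * ((norm (p - p\<^sub>0))\<^sup>2 / 2)) \<longlongrightarrow> A + 0 * ((norm (p - p\<^sub>0))\<^sup>2 / 2)) (at_right 0)"
      by (intro tendsto_intros)
    moreover have "\<forall>\<^sub>F s in at_right 0. 0 \<le> A + s * ((norm (p - p\<^sub>0))\<^sup>2 / 2)"
      unfolding eventually_at_right_field using * by (intro exI[of _ 1]) auto
    ultimately have "0 \<le> A + 0 * ((norm (p - p\<^sub>0))\<^sup>2 / 2)"
      by (rule tendsto_lowerbound) simp
    then show ?thesis
      by (simp add: A_def inner_simps power2_norm_eq_inner inner_commute algebra_simps)
  qed
  with inK show ?thesis using that by blast
qed

text \<open>The set \<open>K\<close> in the proof is the epigraph of the Fitzpatrick function of \<open>A\<close>, which dominates \<open>(x, u) \<mapsto> x \<bullet> u\<close>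
  and agrees with it on the graph of \<open>A\<close>.\<close>
lemma maximal_monotone_ex_minus_self:
  fixes A :: "'a::{real_inner, complete_space} \<Rightarrow> 'a set"
  assumes "maximal_monotone A"
  obtains x where "- x \<in> A x"
proof -
  note mono = monotone_opD[OF maximal_monotone_imp_monotone[OF assms]]
  note maxi = maximal_monotone_memI[OF assms]
  define K :: "(('a \<times> 'a) \<times> real) set" where
    "K = (\<Inter>y. \<Inter>v\<in>A y. {q. fst (fst q) \<bullet> v + y \<bullet> snd (fst q) - y \<bullet> v \<le> snd q})"
  have K_iff: "((x, u), t) \<in> K \<longleftrightarrow> (\<forall>y. \<forall>v\<in>A y. x \<bullet> v + y \<bullet> u - y \<bullet> v \<le> t)" for x u t
    by (auto simp: K_def)
  have "closed K"
    unfolding K_def by (intro closed_INT ballI closed_Collect_le continuous_intros)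
  moreover have "convex K"
    unfolding K_def
  proof (intro convex_INT ballI)
    fix y v
    show "convex {q::('a \<times> 'a) \<times> real. fst (fst q) \<bullet> v + y \<bullet> snd (fst q) - y \<bullet> v \<le> snd q}"
    proof (rule convexI)
      fix p q :: "('a \<times> 'a) \<times> real" and s t :: real
      assume st: "0 \<le> s" "0 \<le> t" "s + t = 1"
      assume "p \<in> {q. fst (fst q) \<bullet> v + y \<bullet> snd (fst q) - y \<bullet> v \<le> snd q}"
        and "q \<in> {q. fst (fst q) \<bullet> v + y \<bullet> snd (fst q) - y \<bullet> v \<le> snd q}"
      then have p: "fst (fst p) \<bullet> v + y \<bullet> snd (fst p) - y \<bullet> v \<le> snd p"
        and q: "fst (fst q) \<bullet> v + y \<bullet> snd (fst q) - y \<bullet> v \<le> snd q" by auto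
      have "s * (fst (fst p) \<bullet> v + y \<bullet> snd (fst p)) + t * (fst (fst q) \<bullet> v + y \<bullet> snd (fst q))
          - (s + t) * (y \<bullet> v) \<le> s * snd p + t * snd q"
        using mult_left_mono[OF p st(1)] mult_left_mono[OF q st(2)] by (simp add: algebra_simps)
      then show "s *\<^sub>R p + t *\<^sub>R q \<in> {q. fst (fst q) \<bullet> v + y \<bullet> snd (fst q) - y \<bullet> v \<le> snd q}"
        unfolding st(3) by (simp add: inner_simps algebra_simps)
    qed
  qed
  moreover have graph_in_K: "((y, v), y \<bullet> v) \<in> K" if "v \<in> A y" for y v
    unfolding K_iff using mono[OF that] by (fastforce simp: inner_simps)
  \<comment> \<open>If the graph of \<open>A\<close> were empty, maximality would vacuously put
    \<open>0\<close> into \<open>A 0\<close>.\<close>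
  have "K \<noteq> {}"
    using maxi[of 0 0] graph_in_K by blast
  moreover have le_K: "x \<bullet> u \<le> t" if "((x, u), t) \<in> K" for x u t
  proof (cases "u \<in> A x")
    case True
    then show ?thesis using that[unfolded K_iff, rule_format, OF True] by simp
  next
    case False
    then obtain y v where "v \<in> A y" "(x - y) \<bullet> (u - v) < 0" using maxi[of x u] by force
    then show ?thesis using that by (fastforce simp: K_iff inner_simps)
  qed
  then have "0 \<le> t + (norm p)\<^sup>2 / 2" if "(p, t) \<in> K" for p t
  proof -
    obtain x u where p: "p = (x, u)" by (cases p)
    have "0 \<le> (norm (x + u))\<^sup>2" by simp
    then show ?thesis using le_K[of x u t] that
      by (simp add: p power2_norm_eq_inner inner_simps inner_commute field_simps)
  qed
  ultimately obtain p t where pt: "(p, t) \<in> K"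
    "\<And>p' t'. (p', t') \<in> K \<Longrightarrow> t + (norm p)\<^sup>2 \<le> t' + p' \<bullet> p"
    using convex_quadratic_minimizer[of K 0] by blast
  obtain x u where p: "p = (x, u)" by (cases p)
  have t: "x \<bullet> u \<le> t" using le_K pt(1) p by blast
  \<comment> \<open>Adding \<open>x \<bullet> u\<close> to the variational inequality completes both
    sides to products.\<close>
  have key: "(norm (x + u))\<^sup>2 \<le> (y + u) \<bullet> (v + x)" if "v \<in> A y" for y v
    using pt(2)[OF graph_in_K[OF that]] t
    by (simp add: p power2_norm_eq_inner inner_simps inner_commute)
  have "- x \<in> A (- u)"
  proof (rule maxi)
    fix y v assume "v \<in> A y"
    then have "0 \<le> (y + u) \<bullet> (v + x)" using key zero_le_power2 order_trans by blast
    then show "0 \<le> (- u - y) \<bullet> (- x - v)" by (simp add: inner_simps)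
  qed
  \<comment> \<open>At the graph point \<open>(- u, - x)\<close> the right-hand side of
    \<open>key\<close> vanishes.\<close>
  moreover from key[OF this] have "x = - u" by (simp add: eq_neg_iff_add_eq_0)
  ultimately show ?thesis using that[of x] by simp
qed

text \<open>Scaling and translating preserve maximal monotonicity, so the previous lemma applies to
  \<open>\<gamma> A - z\<close>, and \<open>- x\<close> in its value at \<open>x\<close> says that
  \<open>z - x\<close> lies in \<open>\<gamma> A x\<close>.\<close>

theorem Minty_surjective:
  fixes A :: "'a::{real_inner, complete_space} \<Rightarrow> 'a set"
  assumes A: "maximal_monotone A" and g: "0 < \<gamma>"
  obtains x u where "u \<in> A x" "z = x + \<gamma> *\<^sub>R u"
proof -
  define A' where "A' x = {u. (1 / \<gamma>) *\<^sub>R (u + z) \<in> A x}" for x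
  have memA': "\<gamma> *\<^sub>R v - z \<in> A' y \<longleftrightarrow> v \<in> A y" for v y using g by (simp add: A'_def)
  have "maximal_monotone A'"
    unfolding maximal_monotone_def monotone_op_def
  proof (intro conjI allI impI)
    fix x y u v assume "u \<in> A' x" "v \<in> A' y"
    then have "0 \<le> (x - y) \<bullet> ((1 / \<gamma>) *\<^sub>R (u + z) - (1 / \<gamma>) *\<^sub>R (v + z))"
      unfolding A'_def mem_Collect_eq
      by (rule monotone_opD[OF maximal_monotone_imp_monotone[OF A]])
    also have "\<dots> = (x - y) \<bullet> (u - v) / \<gamma>"
      by (simp add: inner_simps diff_divide_distrib add_divide_distrib)
    finally show "0 \<le> (x - y) \<bullet> (u - v)" using g by (simp add: zero_le_divide_iff)
  next
    fix x u assume *: "\<forall>y v. v \<in> A' y \<longrightarrow> 0 \<le> (x - y) \<bullet> (u - v)"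
    have "0 \<le> (x - y) \<bullet> ((1 / \<gamma>) *\<^sub>R (u + z) - v)" if "v \<in> A y" for y v
    proof -
      have "0 \<le> (x - y) \<bullet> (u - (\<gamma> *\<^sub>R v - z)) / \<gamma>" using * that memA' g by simp
      also have "\<dots> = (x - y) \<bullet> ((1 / \<gamma>) *\<^sub>R (u + z) - v)"
        using g by (simp add: inner_simps diff_divide_distrib add_divide_distrib)
      finally show ?thesis .
    qed
    then show "u \<in> A' x"
      unfolding A'_def mem_Collect_eq by (rule maximal_monotone_memI[OF A])
  qed
  then obtain x where "- x \<in> A' x" by (rule maximal_monotone_ex_minus_self)
  then have "(1 / \<gamma>) *\<^sub>R (- x + z) \<in> A x" "z = x + \<gamma> *\<^sub>R ((1 / \<gamma>) *\<^sub>R (- x + z))"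
    using g by (auto simp: A'_def)
  then show ?thesis using that by blast
qed

text \<open>Two solutions satisfy \<open>x - y = \<gamma> *\<^sub>R (v - u)\<close>, so monotonicity
  bounds \<open>- \<gamma> * (norm (u - v))\<^sup>2\<close> from below by \<open>0\<close>. This
  uniqueness makes the description in \<open>resolvent\<close> meaningful.\<close>

lemma resolvent_eq:
  assumes A: "monotone_op A" and g: "0 < \<gamma>" and u: "u \<in> A x" "z = x + \<gamma> *\<^sub>R u"
  shows "resolvent \<gamma> A z = x"
  unfolding resolvent_def
proof (rule the_equality)
  show "\<exists>u\<in>A x. z = x + \<gamma> *\<^sub>R u" using u by blast
  fix y assume "\<exists>v\<in>A y. z = y + \<gamma> *\<^sub>R v"
  then obtain v where v: "v \<in> A y" "z = y + \<gamma> *\<^sub>R v" by blast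
  have "0 \<le> (x - y) \<bullet> (u - v)" using monotone_opD[OF A u(1) v(1)] .
  moreover have xy: "x - y = \<gamma> *\<^sub>R (v - u)" using u v by (simp add: algebra_simps)
  have "(x - y) \<bullet> (u - v) = - \<gamma> * (norm (u - v))\<^sup>2"
    unfolding xy by (simp add: power2_norm_eq_inner inner_simps inner_commute algebra_simps)
  ultimately have "(norm (u - v))\<^sup>2 \<le> 0" using g by (simp add: mult_le_0_iff)
  then have "u = v" by simp
  then show "y = x" using u v by simp
qed

lemma resolvent_mem:
  fixes A :: "'a::{real_inner, complete_space} \<Rightarrow> 'a set"
  assumes "maximal_monotone A" "0 < \<gamma>"
  shows "(1 / \<gamma>) *\<^sub>R (z - resolvent \<gamma> A z) \<in> A (resolvent \<gamma> A z)"
proof -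
  obtain x u where xu: "u \<in> A x" "z = x + \<gamma> *\<^sub>R u" using Minty_surjective[OF assms] .
  have "resolvent \<gamma> A z = x"
    by (rule resolvent_eq[where u = u]) (use xu assms maximal_monotone_imp_monotone in auto)
  with xu assms(2) show ?thesis by simp
qed

text \<open>Testing against the resolvent of a small multiple of \<open>A\<close> absorbs the Lipschitz perturbation.\<close>
lemma maximal_monotone_add_lipschitz:
  fixes A :: "'a::{real_inner, complete_space} \<Rightarrow> 'a set"
  assumes A: "maximal_monotone A" and M: "\<And>x y. norm (M x - M y) \<le> c * norm (x - y)"
    and *: "\<And>y v. v \<in> A y \<Longrightarrow> 0 \<le> (y - x) \<bullet> (v + M y - w)"
  shows "w - M x \<in> A x"
proof -
  \<comment> \<open>Chosen so that \<open>1 / t\<close> exceeds \<open>c\<close>; the final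
    inequality then forces \<open>y = x\<close>.\<close>
  define t where "t = 1 / (\<bar>c\<bar> + 1)"
  have t: "0 < t" by (simp add: t_def)
  obtain y v where yv: "v \<in> A y" "x + t *\<^sub>R (w - M x) = y + t *\<^sub>R v"
    using Minty_surjective[OF A t] .
  then have "t *\<^sub>R (v - (w - M x)) = x - y" by (simp add: algebra_simps)
  then have v: "v - (w - M x) = (1 / t) *\<^sub>R (x - y)" using t by (metis divideR_right less_irrefl inverse_eq_divide)
  have "0 \<le> (y - x) \<bullet> ((1 / t) *\<^sub>R (x - y) + (M y - M x))"
    using *[OF yv(1)] unfolding v[symmetric] by (simp add: algebra_simps)
  also have "\<dots> = - (1 / t) * (norm (y - x))\<^sup>2 + (y - x) \<bullet> (M y - M x)"
    by (simp add: power2_norm_eq_inner inner_simps inner_commute algebra_simps)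
  also have "(y - x) \<bullet> (M y - M x) \<le> norm (y - x) * (c * norm (y - x))"
    using norm_cauchy_schwarz[of "y - x" "M y - M x"] M[of y x]
    by (meson mult_left_mono norm_ge_zero order_trans)
  finally have "(1 / t - c) * (norm (y - x))\<^sup>2 \<le> 0" by (simp add: algebra_simps power2_eq_square)
  moreover have "1 / t - c > 0" by (simp add: t_def)
  ultimately have "(norm (y - x))\<^sup>2 \<le> 0" by (simp add: mult_le_0_iff)
  then have "y = x" by simp
  with yv v show ?thesis by simp
qed

section \<open>Weak sequential compactness\<close>

text \<open>The quadratic minimizer over the translate of \<open>W\<close> by \<open>- w\<close>,
  with all heights \<open>0\<close>, is \<open>p - w\<close> for the projection \<open>p\<close>.
  Its variational inequality holds for \<open>v\<close> and for \<open>- v\<close>, hence is an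
  equality.\<close>

lemma closed_subspace_orthogonal_decomposition:
  fixes W :: "'b::{real_inner, complete_space} set"
  assumes clW: "closed W" and W: "subspace W"
  obtains p q where "p \<in> W" "\<And>v. v \<in> W \<Longrightarrow> v \<bullet> q = 0" "w = p + q"
proof -
  define K where "K = (\<lambda>v. v - w) ` W \<times> {0::real}"
  have "closed K" unfolding K_def
    using clW by (intro closed_Times) (auto simp: closed_translation_subtract)
  moreover have "convex K" unfolding K_def
    using subspace_imp_convex[OF W] by (intro convex_Times) (auto simp: convex_translation_subtract)
  moreover have "K \<noteq> {}" using W by (auto simp: K_def subspace_def)
  moreover have "0 \<le> t + (norm p)\<^sup>2 / 2" if "(p, t) \<in> K" for p t
    using that by (auto simp: K_def)
  ultimately obtain r t where rt: "(r, t) \<in> K"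
    "\<And>p' t'. (p', t') \<in> K \<Longrightarrow> t + (norm r)\<^sup>2 \<le> t' + p' \<bullet> r"
    using convex_quadratic_minimizer[of K 0] by blast
  then obtain p where p: "p \<in> W" "r = p - w" "t = 0" by (auto simp: K_def)
  have ge: "0 \<le> v \<bullet> r" if "v \<in> W" for v
  proof -
    have "(p + v - w, 0) \<in> K" using p that W by (auto simp: K_def subspace_add)
    then have "(norm r)\<^sup>2 \<le> (p + v - w) \<bullet> r" using rt(2) p(3) by fastforce
    then show ?thesis by (simp add: p(2) power2_norm_eq_inner inner_simps)
  qed
  have "v \<bullet> (w - p) = 0" if "v \<in> W" for v
    using ge[OF that] ge[OF subspace_neg[OF W that]] by (simp add: p(2) inner_simps)
  then show ?thesis using that[of p "w - p"] p(1) by simp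
qed

text \<open>Minimizing \<open>(norm p)\<^sup>2 / 2 - f p\<close>, that is, taking \<open>K\<close>
  as the epigraph of \<open>- f\<close>, yields \<open>l\<close> for which the linear functional
  \<open>g\<close> is bounded below. Such a functional is \<open>0\<close>.\<close>

lemma Riesz_representation:
  fixes f :: "'b::{real_inner, complete_space} \<Rightarrow> real"
  assumes f: "bounded_linear f"
  obtains l where "\<And>w. f w = l \<bullet> w"
proof -
  interpret f: bounded_linear f by fact
  obtain M where M: "\<And>w. \<bar>f w\<bar> \<le> norm w * M" using f.bounded by auto
  define K where "K = {q. - f (fst q) \<le> snd q}"
  have "closed K" unfolding K_def
    by (intro closed_Collect_le continuous_intros f.continuous_on)
  moreover have "convex K"
  proof (rule convexI)
    fix p q s t assume st: "0 \<le> s" "0 \<le> (t::real)" "s + t = 1" and "p \<in> K" "q \<in> K"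
    then have "s * - f (fst p) \<le> s * snd p" "t * - f (fst q) \<le> t * snd q"
      unfolding K_def mem_Collect_eq by (blast intro: mult_left_mono)+
    then show "s *\<^sub>R p + t *\<^sub>R q \<in> K" by (simp add: K_def f.add f.scaleR)
  qed
  moreover have "K \<noteq> {}" by (auto simp: K_def intro: exI[of _ 0])
  moreover have "- (M\<^sup>2 / 2) \<le> t + (norm p)\<^sup>2 / 2" if "(p, t) \<in> K" for p t
  proof -
    have "0 \<le> (norm p - M)\<^sup>2" by simp
    then show ?thesis using that M[of p] by (simp add: K_def power2_eq_square algebra_simps)
  qed
  ultimately obtain l t where lt: "(l, t) \<in> K"
    "\<And>p' t'. (p', t') \<in> K \<Longrightarrow> t + (norm l)\<^sup>2 \<le> t' + p' \<bullet> l"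
    using convex_quadratic_minimizer[of K "- (M\<^sup>2 / 2)"] by blast
  define g where "g w = w \<bullet> l - f w" for w
  have g: "t + (norm l)\<^sup>2 \<le> g w" for w using lt(2)[of w "- f w"] by (simp add: K_def g_def)
  have "g w = 0" for w
  proof (rule ccontr)
    assume nz: "g w \<noteq> 0"
    have "g (c *\<^sub>R w) = c * g w" for c by (simp add: g_def f.scaleR algebra_simps)
    then have "t + (norm l)\<^sup>2 \<le> ((t + (norm l)\<^sup>2 - 1) / g w) * g w"
      using g[of "((t + (norm l)\<^sup>2 - 1) / g w) *\<^sub>R w"] by simp
    then show False using nz by simp
  qed
  then show ?thesis using that[of l] by (simp add: g_def inner_commute)
qed

lemma bounded_real_convergent_subsequence:
  fixes f :: "nat \<Rightarrow> real"
  assumes "\<And>n. \<bar>f n\<bar> \<le> M"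
  obtains r where "strict_mono r" "convergent (f \<circ> r)"
proof -
  have "bounded (range f)" using assms by (auto simp: bounded_iff)
  then obtain l r where "strict_mono r" "(f \<circ> r) \<longlonglongrightarrow> l"
    using bounded_imp_convergent_subsequence by blast
  then show ?thesis using that convergentI by blast
qed

text \<open>Separability is avoided by diagonalizing only over the test vectors \<open>s m\<close>.
  The vectors against which the subsequence converges form a closed subspace containing all
  \<open>s m\<close>, and vectors orthogonal to it pair to \<open>0\<close>. Riesz then represents
  the limit functional.\<close>

theorem bounded_imp_weakly_convergent_subsequence:
  fixes s :: "nat \<Rightarrow> 'b::{real_inner, complete_space}"
  assumes bd: "\<And>n. norm (s n) \<le> M"
  obtains r l where "strict_mono r" "weakly_converges (s \<circ> r) l"
proof -
  have M0: "0 \<le> M" using bd[of 0] norm_ge_zero order_trans by blast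
  have bdw: "\<bar>s n \<bullet> w\<bar> \<le> M * norm w" for n w
    using Cauchy_Schwarz_ineq2[of "s n" w] mult_right_mono[OF bd norm_ge_zero] order_trans by blast
  define P where "P m k \<longleftrightarrow> convergent (\<lambda>n. s (k n) \<bullet> s m)" for m and k :: "nat \<Rightarrow> nat"
  interpret sub: subseqs P
  proof
    fix m k assume "strict_mono (k :: nat \<Rightarrow> nat)"
    obtain r where "strict_mono r" "convergent ((\<lambda>n. s (k n) \<bullet> s m) \<circ> r)"
      using bounded_real_convergent_subsequence[of "\<lambda>n. s (k n) \<bullet> s m"] bdw by blast
    then show "\<exists>r. strict_mono r \<and> P m (k \<circ> r)" by (auto simp: P_def o_def)
  qed
  define r where "r = sub.diagseq"
  have r: "strict_mono r" using sub.subseq_diagseq by (simp add: r_def)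
  have conv_s: "convergent (\<lambda>n. s (r n) \<bullet> s m)" for m
  proof -
    \<comment> \<open>The diagonal sequence is a subsequence of the stage that settles
      \<open>m\<close> only from index \<open>Suc m\<close> on.\<close>
    have "P m (sub.diagseq \<circ> (+) (Suc m))"
    proof (rule sub.diagseq_holds)
      fix k' k m assume "strict_mono (k' :: nat \<Rightarrow> nat)" "P m k"
      then show "P m (k \<circ> k')"
        using convergent_subseq_convergent[of "\<lambda>n. s (k n) \<bullet> s m" k'] by (simp add: P_def o_def)
    qed
    then have "convergent (\<lambda>n. s (r (n + Suc m)) \<bullet> s m)" by (simp add: P_def r_def o_def add.commute)
    then show ?thesis using convergent_ignore_initial_segment[of "\<lambda>n. s (r n) \<bullet> s m" "Suc m"] by simp
  qed
  define W where "W = {w. convergent (\<lambda>n. s (r n) \<bullet> w)}"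
  have subW: "subspace W"
    by (auto simp: subspace_def W_def inner_simps intro!: convergent_add convergent_mult convergent_const)
  have "closed W"
  proof (rule closed_sequential_limits[THEN iffD2], intro allI impI)
    fix f w assume f: "(\<forall>n. f n \<in> W) \<and> f \<longlonglongrightarrow> w"
    have "Cauchy (\<lambda>n. s (r n) \<bullet> w)"
    proof (rule metric_CauchyI)
      fix e :: real assume e: "0 < e"
      \<comment> \<open>With \<open>M + 1\<close> in place of \<open>M\<close> the quotient is well
        defined even for \<open>M = 0\<close>.\<close>
      define d where "d = e / (3 * (M + 1))"
      have d: "0 < d" using e M0 by (simp add: d_def)
      then obtain k where k: "norm (f k - w) < d"
        using f by (metis LIMSEQ_D order_refl)
      have near: "\<bar>s (r n) \<bullet> f k - s (r n) \<bullet> w\<bar> < e / 3" for n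
      proof -
        have "\<bar>s (r n) \<bullet> f k - s (r n) \<bullet> w\<bar> \<le> M * norm (f k - w)"
          using bdw[of "r n" "f k - w"] by (simp add: inner_simps)
        also have "\<dots> \<le> M * d" using k M0 by (intro mult_left_mono) auto
        also have "\<dots> < (M + 1) * d" using d by simp
        also have "\<dots> = e / 3" using M0 by (simp add: d_def field_simps)
        finally show ?thesis .
      qed
      have "Cauchy (\<lambda>n. s (r n) \<bullet> f k)" using f by (auto simp: W_def intro: convergent_Cauchy)
      then obtain N where N: "\<And>i j. i \<ge> N \<Longrightarrow> j \<ge> N \<Longrightarrow> \<bar>s (r i) \<bullet> f k - s (r j) \<bullet> f k\<bar> < e / 3"
        using e metric_CauchyD[of "\<lambda>n. s (r n) \<bullet> f k" "e / 3"] by (auto simp: dist_real_def)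
      have "dist (s (r i) \<bullet> w) (s (r j) \<bullet> w) < e" if "i \<ge> N" "j \<ge> N" for i j
        using N[OF that] near[of i] near[of j] unfolding dist_real_def by linarith
      then show "\<exists>N. \<forall>i\<ge>N. \<forall>j\<ge>N. dist (s (r i) \<bullet> w) (s (r j) \<bullet> w) < e" by blast
    qed
    then show "w \<in> W" by (simp add: W_def Cauchy_convergent_iff)
  qed
  have conv: "convergent (\<lambda>n. s (r n) \<bullet> w)" for w
  proof -
    obtain p q where pq: "p \<in> W" "\<And>v. v \<in> W \<Longrightarrow> v \<bullet> q = 0" "w = p + q"
      using closed_subspace_orthogonal_decomposition[OF \<open>closed W\<close> subW, of w] by blast
    have "s m \<in> W" for m using conv_s by (simp add: W_def)
    then have "(\<lambda>n. s (r n) \<bullet> w) = (\<lambda>n. s (r n) \<bullet> p)" using pq by (simp add: inner_simps)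
    then show ?thesis using pq(1) by (simp add: W_def)
  qed
  define f where "f w = lim (\<lambda>n. s (r n) \<bullet> w)" for w
  have lim: "(\<lambda>n. s (r n) \<bullet> w) \<longlonglongrightarrow> f w" for w
    using conv by (simp add: f_def convergent_LIMSEQ_iff)
  have "bounded_linear f"
  proof (rule bounded_linear_intro[where K = M])
    fix v w and c :: real
    show "f (v + w) = f v + f w"
      using tendsto_add[OF lim[of v] lim[of w]] LIMSEQ_unique[OF lim[of "v + w"]]
      by (simp add: inner_simps)
    show "f (c *\<^sub>R w) = c *\<^sub>R f w"
      using tendsto_mult[OF tendsto_const[of c] lim[of w]] LIMSEQ_unique[OF lim[of "c *\<^sub>R w"]]
      by simp
    show "norm (f w) \<le> norm w * M"
      using LIMSEQ_le_const2[OF tendsto_rabs[OF lim[of w]], of "norm w * M"] bdw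
      by (auto simp: mult.commute)
  qed
  then obtain l where "\<And>w. f w = l \<bullet> w" using Riesz_representation by blast
  then have "weakly_converges (s \<circ> r) l" using lim by (simp add: weakly_converges_def)
  with r show ?thesis using that by blast
qed

text \<open>If the pairing with some \<open>w\<close> failed to converge, a subsequence would stay
  away from \<open>l \<bullet> w\<close>; compactness extracts from it a cluster point, which must
  be \<open>l\<close> again.\<close>

lemma weakly_converges_if_unique_cluster_point:
  fixes s :: "nat \<Rightarrow> 'b::{real_inner, complete_space}"
  assumes bd: "\<And>n. norm (s n) \<le> M"
    and uniq: "\<And>r l l' r'. strict_mono r \<Longrightarrow> weakly_converges (s \<circ> r) l \<Longrightarrow>
                 strict_mono r' \<Longrightarrow> weakly_converges (s \<circ> r') l' \<Longrightarrow> l = l'"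
  obtains l where "weakly_converges s l"
proof -
  obtain r l where rl: "strict_mono r" "weakly_converges (s \<circ> r) l"
    using bounded_imp_weakly_convergent_subsequence[of s M] bd by blast
  have "(\<lambda>n. s n \<bullet> w) \<longlonglongrightarrow> l \<bullet> w" for w
  proof (rule ccontr)
    assume "\<not> ?thesis"
    then obtain e where e: "e > 0" "\<exists>\<^sub>F n in sequentially. e \<le> \<bar>s n \<bullet> w - l \<bullet> w\<bar>"
      by (auto simp: tendsto_iff dist_real_def frequently_def not_le)
    then have inf: "infinite {n. e \<le> \<bar>s n \<bullet> w - l \<bullet> w\<bar>}"
      by (simp add: frequently_cofinite[symmetric] cofinite_eq_sequentially)
    then obtain k :: "nat \<Rightarrow> nat" where k: "strict_mono k" "\<And>n. e \<le> \<bar>s (k n) \<bullet> w - l \<bullet> w\<bar>"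
      using infinite_enumerate[OF inf] by auto
    obtain r' l' where r': "strict_mono r'" "weakly_converges ((s \<circ> k) \<circ> r') l'"
      using bounded_imp_weakly_convergent_subsequence[of "s \<circ> k" M] bd by auto
    then have "l' = l"
      using uniq[of "k \<circ> r'" l' r l] rl strict_mono_o[OF k(1) r'(1)] by (simp add: o_assoc)
    then have "(\<lambda>n. s (k (r' n)) \<bullet> w) \<longlonglongrightarrow> l \<bullet> w" using r'(2) by (simp add: weakly_converges_def)
    then have "(\<lambda>n. \<bar>s (k (r' n)) \<bullet> w - l \<bullet> w\<bar>) \<longlonglongrightarrow> 0" by (simp add: LIM_zero_iff tendsto_rabs_zero)
    then have "e \<le> 0" by (rule LIMSEQ_le_const) (use k(2) in auto)
    with e show False by simp
  qed
  then show ?thesis using that[of l] by (simp add: weakly_converges_def)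
qed

section \<open>The Lyapunov function of the iteration\<close>

text \<open>The two monotonicity products add up to half of the difference of squares. Phrasing it
  in terms of differences lets it serve both the comparison with a solution and the comparison of
  consecutive iterates.\<close>

lemma splitting_step_estimate:
  fixes dx dy dz db :: "'a::real_inner"
  assumes g: "0 < \<gamma>" and "0 \<le> dx \<bullet> ((1 / \<gamma>) *\<^sub>R (dz - dx))"
    and "0 \<le> dy \<bullet> ((1 / \<gamma>) *\<^sub>R (2 *\<^sub>R dx - dz - dy) - db)"
  shows "(norm (dz + (dy - dx)))\<^sup>2 \<le> (norm dz)\<^sup>2 - (norm (dy - dx))\<^sup>2 - 2 * \<gamma> * (dy \<bullet> db)"
proof -
  have 1: "0 \<le> dx \<bullet> (dz - dx)" using assms(2) g by (simp add: zero_le_divide_iff)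
  have "0 \<le> \<gamma> * (dy \<bullet> ((1 / \<gamma>) *\<^sub>R (2 *\<^sub>R dx - dz - dy) - db))"
    using assms(1,3) by (intro mult_nonneg_nonneg) auto
  also have "\<dots> = dy \<bullet> (2 *\<^sub>R dx - dz - dy) - \<gamma> * (dy \<bullet> db)"
    using g by (simp add: inner_diff_right[of _ _ db] right_diff_distrib)
  finally have 2: "\<gamma> * (dy \<bullet> db) \<le> dy \<bullet> (2 *\<^sub>R dx - dz - dy)" by simp
  have "(norm dz)\<^sup>2 - (norm (dy - dx))\<^sup>2 - (norm (dz + (dy - dx)))\<^sup>2
      = 2 * (dx \<bullet> (dz - dx)) + 2 * (dy \<bullet> (2 *\<^sub>R dx - dz - dy))"
    unfolding power2_norm_eq_inner by (simp add: inner_simps inner_commute)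
  then show ?thesis using 1 2 by linarith
qed

text \<open>Here \<open>v\<close> is the difference at which \<open>C\<close> is evaluated and
  \<open>t\<close> the difference it is tested with. Completing the square shows that only the
  mismatch \<open>t - v\<close> costs anything.\<close>

lemma cocoercive_estimate:
  fixes c t v :: "'a::real_inner"
  assumes b: "0 < \<beta>" and g: "0 \<le> \<gamma>" and c: "\<beta> * (norm c)\<^sup>2 \<le> v \<bullet> c"
  shows "- (2 * \<gamma> * (t \<bullet> c)) \<le> \<gamma> / (2 * \<beta>) * (norm (t - v))\<^sup>2"
proof -
  have "0 \<le> (norm ((t - v) + (2 * \<beta>) *\<^sub>R c))\<^sup>2" by simp
  also have "\<dots> = (norm (t - v))\<^sup>2 + 4 * \<beta> * (t \<bullet> c) + 4 * \<beta> * (\<beta> * (norm c)\<^sup>2 - v \<bullet> c)"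
    unfolding power2_norm_eq_inner by (simp add: inner_simps inner_commute algebra_simps)
  also have "\<dots> \<le> (norm (t - v))\<^sup>2 + 4 * \<beta> * (t \<bullet> c)"
    using b c by (simp add: mult_le_0_iff)
  finally have "0 \<le> \<gamma> / (2 * \<beta>) * ((norm (t - v))\<^sup>2 + 4 * \<beta> * (t \<bullet> c))"
    using b g by (intro mult_nonneg_nonneg) auto
  also have "\<dots> = \<gamma> / (2 * \<beta>) * (norm (t - v))\<^sup>2 + 2 * \<gamma> * (t \<bullet> c)"
    using b by (simp add: field_simps)
  finally show ?thesis by linarith
qed

text \<open>The numbers \<open>7, -6, 4\<close> and \<open>37/2\<close> were found numerically as a solution of the linear matrix
  inequality that bounds \<open>\<Sum> \<parallel>2 Y\<^sub>n\<^sub>+\<^sub>1 - Y\<^sub>n\<parallel>\<^sup>2\<close> by \<open>5 \<Sum> (\<parallel>Z\<^sub>n\<parallel>\<^sup>2 + 2 \<parallel>Z\<^sub>n\<^sub>+\<^sub>1 - Z\<^sub>n\<parallel>\<^sup>2)\<close> up to a telescoping term;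
  the squares in the proof are its LDL factorisation.\<close>
lemma storage_estimate:
  fixes X Y Z W Y' :: "'a::real_inner"
  assumes Y': "Y' = X + W - Z" and firm: "(norm X)\<^sup>2 \<le> X \<bullet> Z"
  shows "(norm (2 *\<^sub>R Y' - Y))\<^sup>2 + (7 * (norm W)\<^sup>2 - 6 * (W \<bullet> Y') + 4 * (norm Y')\<^sup>2)
    \<le> 5 * ((norm W)\<^sup>2 + 2 * (norm (W - Z))\<^sup>2)
      + (7 * (norm Z)\<^sup>2 - 6 * (Z \<bullet> Y) + 4 * (norm Y)\<^sup>2)"
proof -
  have "0 \<le> 3 * (norm (Y - (5/3) *\<^sub>R Z + (2/3) *\<^sub>R X + (2/3) *\<^sub>R W))\<^sup>2
      + 2/3 * (norm (Z + (25/8) *\<^sub>R X - (5/2) *\<^sub>R W))\<^sup>2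
      + 1/2 * (norm (W - (9/4) *\<^sub>R X))\<^sup>2 + 1/8 * (norm X)\<^sup>2"
    by simp
  also have "\<dots> = 5 * ((norm W)\<^sup>2 + 2 * (norm (W - Z))\<^sup>2) - 37/2 * (X \<bullet> Z - (norm X)\<^sup>2)
      + (7 * (norm Z)\<^sup>2 - 6 * (Z \<bullet> Y) + 4 * (norm Y)\<^sup>2)
      - ((norm (2 *\<^sub>R Y' - Y))\<^sup>2 + (7 * (norm W)\<^sup>2 - 6 * (W \<bullet> Y') + 4 * (norm Y')\<^sup>2))"
    unfolding Y' power2_norm_eq_inner
    by (simp add: inner_simps inner_commute) (simp add: field_simps)
  finally show ?thesis using firm by argo
qed

text \<open>Ten times the gap is a sum of five nonnegative terms: two squares absorb the products of
  \<open>d\<close> with \<open>f\<close> and with \<open>\<zeta>\<close>, the third term uses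
  \<open>l \<le> 1/10\<close>, the fourth trades \<open>l\<close> for \<open>\<kappa>\<close>, and
  the fifth is a positive definite form in \<open>e\<close> and \<open>d\<close>.\<close>

lemma lyapunov_lower_estimate:
  fixes \<zeta> e d f l \<kappa> :: real
  assumes l: "0 \<le> l" "2 * l \<le> \<kappa>" "\<kappa> \<le> 1/5" and ed: "0 \<le> e" "0 \<le> d"
  shows "\<zeta>\<^sup>2 / 2 \<le> \<zeta>\<^sup>2 + l * f\<^sup>2 + \<kappa> * (7 * e\<^sup>2 - 6 * (e * d) + 4 * d\<^sup>2)
    - 2 * l * (d * (\<zeta> + 2 * e + d + f))"
proof -
  have 1: "0 \<le> l * (d - f)\<^sup>2" using l by simp
  have 2: "0 \<le> (\<zeta> - 2 * l * d)\<^sup>2" by simp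
  have 3: "0 \<le> l * (1 - 10 * l) * d\<^sup>2" using l by simp
  have 4: "0 \<le> (\<kappa> - 2 * l) * (8 * d\<^sup>2 + 10 * (d * e))" using l ed by simp
  have "35 * e\<^sup>2 - 40 * (e * d) + 12 * d\<^sup>2 = 35 * (e - 4/7 * d)\<^sup>2 + 4/7 * d\<^sup>2"
    by (simp add: power2_eq_square algebra_simps)
  then have 5: "0 \<le> \<kappa> * (35 * e\<^sup>2 - 40 * (e * d) + 12 * d\<^sup>2)" using l by simp
  have "0 \<le> 10 * (l * (d - f)\<^sup>2) + 5 * (\<zeta> - 2 * l * d)\<^sup>2 + 2 * (l * (1 - 10 * l) * d\<^sup>2)
      + 2 * ((\<kappa> - 2 * l) * (8 * d\<^sup>2 + 10 * (d * e))) + 2 * (\<kappa> * (35 * e\<^sup>2 - 40 * (e * d) + 12 * d\<^sup>2))"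
    using 1 2 3 4 5 by linarith
  also have "\<dots> = 10 * (\<zeta>\<^sup>2 / 2 + l * f\<^sup>2 + \<kappa> * (7 * e\<^sup>2 - 6 * (e * d) + 4 * d\<^sup>2)
    - 2 * l * (d * (\<zeta> + 2 * e + d + f)))"
    by (simp add: power2_eq_square algebra_simps)
  finally show ?thesis by simp
qed

lemma tendsto_inner_bounded_null:
  fixes f g :: "nat \<Rightarrow> 'a::real_inner"
  assumes f: "\<And>n. norm (f n) \<le> M" and g: "g \<longlonglongrightarrow> 0"
  shows "(\<lambda>n. f n \<bullet> g n) \<longlonglongrightarrow> 0"
proof (rule Lim_null_comparison)
  show "\<forall>\<^sub>F n in sequentially. norm (f n \<bullet> g n) \<le> M * norm (g n)"
    using order_trans[OF Cauchy_Schwarz_ineq2 mult_right_mono[OF f norm_ge_zero]]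
    by (intro always_eventually allI) (simp only: real_norm_def)
  show "(\<lambda>n. M * norm (g n)) \<longlonglongrightarrow> 0"
    using tendsto_mult[OF tendsto_const tendsto_norm[OF g], of M] by simp
qed

text \<open>Inclusions replace the resolvent recursion, since monotonicity applies to them directly.
  \<open>y_incl\<close> begins with the second iteration, whose extrapolation involves
  \<open>y 1\<close> and \<open>y 0\<close> but not the extra initial value.
  \<open>step_size\<close> is what remains of the upper bound on \<gamma>.\<close>

locale splitting_iteration =
  fixes A1 A2 :: "'a::{real_inner, complete_space} \<Rightarrow> 'a set" and B C :: "'a \<Rightarrow> 'a"
    and L \<beta> \<gamma> :: real and x y z :: "nat \<Rightarrow> 'a"
  assumes A1: "maximal_monotone A1" and A2: "maximal_monotone A2"
    and Bmono: "0 \<le> (u - v) \<bullet> (B u - B v)"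
    and Blip: "norm (B u - B v) \<le> L * norm (u - v)" and L_nonneg: "0 \<le> L"
    and Ccoco: "\<beta> * (norm (C u - C v))\<^sup>2 \<le> (u - v) \<bullet> (C u - C v)" and \<beta>_pos: "0 < \<beta>"
    and \<gamma>_pos: "0 < \<gamma>" and step_size: "\<gamma> / (2 * \<beta>) + 2 * (\<gamma> * L) < 1 / 5"
    and x_incl: "(1 / \<gamma>) *\<^sub>R (z n - x (Suc n)) \<in> A1 (x (Suc n))"
    and y_incl: "(1 / \<gamma>) *\<^sub>R (2 *\<^sub>R x (Suc (Suc n)) - z (Suc n) - y (Suc (Suc n)))
        - (B (2 *\<^sub>R y (Suc n) - y n) + C (y (Suc n))) \<in> A2 (y (Suc (Suc n)))"
    and z_rec: "z (Suc n) = z n + y (Suc n) - x (Suc n)"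
begin

text \<open>A stationary state of the iteration: \<open>z = q\<close> and
  \<open>x = y = p\<close>.\<close>

definition fixed_pair :: "'a \<Rightarrow> 'a \<Rightarrow> bool" where
  "fixed_pair p q \<longleftrightarrow> (1 / \<gamma>) *\<^sub>R (q - p) \<in> A1 p \<and> (1 / \<gamma>) *\<^sub>R (p - q) - (B p + C p) \<in> A2 p"

definition w :: "nat \<Rightarrow> 'a" where "w n = 2 *\<^sub>R y (Suc n) - y n"
definition dz :: "nat \<Rightarrow> 'a" where "dz n = z (Suc n) - z n"
definition dy :: "nat \<Rightarrow> 'a" where "dy n = y (Suc n) - y n"

text \<open>Total weight of the errors
  \<open>(norm (2 *\<^sub>R dy (Suc n) - dy n))\<^sup>2\<close>: \<open>C\<close> contributes the
  first summand, and \<open>B\<close> contributes \<open>\<gamma> * L\<close> twice, once directly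
  and once through the telescoping term in \<open>V\<close>.\<close>

definition \<kappa> :: real where "\<kappa> = \<gamma> / (2 * \<beta>) + 2 * (\<gamma> * L)"

text \<open>The factor \<open>2\<close> at \<open>dz\<close> comes from adding the estimate for
  consecutive iterates twice. The next three summands carry error terms of the preceding step so
  that they telescope, and the last is \<kappa> times the quadratic form of
  \<open>storage_estimate\<close>.\<close>

definition V :: "'a \<Rightarrow> 'a \<Rightarrow> nat \<Rightarrow> real" where
  "V p q n = (norm (z (Suc (Suc n)) - q))\<^sup>2 + 2 * (norm (dz (Suc n)))\<^sup>2
     + 2 * \<gamma> * (dy (Suc n) \<bullet> (B (w n) - B p))
     + \<gamma> / (2 * \<beta>) * (norm (dy (Suc n)))\<^sup>2 + \<gamma> * L * (norm (2 *\<^sub>R dy (Suc n) - dy n))\<^sup>2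
     + \<kappa> * (7 * (norm (dz (Suc n)))\<^sup>2 - 6 * (dz (Suc n) \<bullet> dy (Suc n)) + 4 * (norm (dy (Suc n)))\<^sup>2)"

lemma \<kappa>_bounds: "0 < 1 - 5 * \<kappa>" "0 \<le> \<kappa>" "2 * (\<gamma> * L) \<le> \<kappa>"
  using step_size \<gamma>_pos \<beta>_pos L_nonneg by (auto simp: \<kappa>_def)

lemma A1_monotone: "0 \<le> (u - v) \<bullet> ((1 / \<gamma>) *\<^sub>R ((q - q') - (u - v)))"
  if "(1 / \<gamma>) *\<^sub>R (q - u) \<in> A1 u" "(1 / \<gamma>) *\<^sub>R (q' - v) \<in> A1 v"
proof -
  have "(1 / \<gamma>) *\<^sub>R (q - u) - (1 / \<gamma>) *\<^sub>R (q' - v) = (1 / \<gamma>) *\<^sub>R ((q - q') - (u - v))"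
    by (simp add: scaleR_diff_right)
  then show ?thesis using monotone_opD[OF maximal_monotone_imp_monotone[OF A1] that] by simp
qed

lemma A2_monotone: "0 \<le> (u - v) \<bullet> ((1 / \<gamma>) *\<^sub>R (2 *\<^sub>R (a - a') - (q - q') - (u - v)) - (b - b'))"
  if "(1 / \<gamma>) *\<^sub>R (2 *\<^sub>R a - q - u) - b \<in> A2 u" "(1 / \<gamma>) *\<^sub>R (2 *\<^sub>R a' - q' - v) - b' \<in> A2 v"
proof -
  have "((1 / \<gamma>) *\<^sub>R (2 *\<^sub>R a - q - u) - b) - ((1 / \<gamma>) *\<^sub>R (2 *\<^sub>R a' - q' - v) - b')
      = (1 / \<gamma>) *\<^sub>R (2 *\<^sub>R (a - a') - (q - q') - (u - v)) - (b - b')"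
    by (simp add: scaleR_diff_right)
  then show ?thesis using monotone_opD[OF maximal_monotone_imp_monotone[OF A2] that] by metis
qed

lemma A1_firm: "(norm (u - v))\<^sup>2 \<le> (u - v) \<bullet> (q - q')"
  if "(1 / \<gamma>) *\<^sub>R (q - u) \<in> A1 u" "(1 / \<gamma>) *\<^sub>R (q' - v) \<in> A1 v"
proof -
  have "0 \<le> (u - v) \<bullet> ((q - q') - (u - v))"
    using A1_monotone[OF that] \<gamma>_pos by (simp add: zero_le_divide_iff)
  then show ?thesis unfolding power2_norm_eq_inner by (simp only: inner_diff_right[of _ "q - q'"])
qed

lemma A1_nonexpansive: "norm (u - v) \<le> norm (q - q')"
  if "(1 / \<gamma>) *\<^sub>R (q - u) \<in> A1 u" "(1 / \<gamma>) *\<^sub>R (q' - v) \<in> A1 v"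
proof -
  have "norm (u - v) * norm (u - v) \<le> norm (u - v) * norm (q - q')"
    using A1_firm[OF that] norm_cauchy_schwarz[of "u - v" "q - q'"] by (simp add: power2_eq_square)
  then show ?thesis by (cases "u = v") (auto simp: mult_le_cancel_left)
qed

lemma y_eq: "y (Suc n) = x (Suc n) + dz n"
  by (simp add: dz_def z_rec)

lemma dy_eq: "dy (Suc n) = (x (Suc (Suc n)) - x (Suc n)) + dz (Suc n) - dz n"
  by (simp add: dy_def y_eq)

lemma C_lipschitz: "norm (C u - C v) \<le> 1 / \<beta> * norm (u - v)"
proof -
  have "norm (C u - C v) * (\<beta> * norm (C u - C v)) \<le> norm (C u - C v) * norm (u - v)"
    using Ccoco[of u v] norm_cauchy_schwarz[of "u - v" "C u - C v"]
    by (simp add: power2_eq_square algebra_simps)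
  then have "\<beta> * norm (C u - C v) \<le> norm (u - v)"
    by (cases "C u = C v") (auto simp: mult_le_cancel_left)
  then show ?thesis using \<beta>_pos by (simp add: field_simps)
qed

text \<open>\<open>main\<close> compares with the solution and \<open>diff\<close> compares
  consecutive iterates. In the sum of \<open>main\<close> and twice \<open>diff\<close>,
  \<open>lip\<close> and \<open>filt\<close> reduce the errors to \<kappa> times \<open>Q\<close>
  plus telescoping terms, and \<open>cert\<close> pays for them with the decrements.\<close>

lemma V_decreasing:
  assumes pq: "fixed_pair p q"
  shows "V p q (Suc n) \<le> V p q n - (1 - 5 * \<kappa>) * (norm (dz (Suc (Suc n))))\<^sup>2"
proof -
  define Z W Y Y' Y0 X where "Z = dz (Suc n)" and "W = dz (Suc (Suc n))" and "Y = dy (Suc n)"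
    and "Y' = dy (Suc (Suc n))" and "Y0 = dy n"
    and "X = x (Suc (Suc (Suc n))) - x (Suc (Suc n))"
  note defs = Z_def W_def Y_def Y'_def Y0_def X_def
  define E E' G H D where "E = B (w n) - B p" and "E' = B (w (Suc n)) - B p"
    and "G = B (w (Suc n)) - B (w n)" and "H = C (y (Suc (Suc n))) - C (y (Suc n))"
    and "D = C (y (Suc (Suc n))) - C p"
  have E': "E' = E + G" by (simp add: E_def E'_def G_def)
  have Y': "Y' = X + W - Z" by (simp add: defs dy_eq)
  define s where "s = y (Suc (Suc (Suc n))) - p"
  have inc: "(1 / \<gamma>) *\<^sub>R (2 *\<^sub>R p - q - p) - (B p + C p) \<in> A2 p" "(1 / \<gamma>) *\<^sub>R (q - p) \<in> A1 p"
    using pq by (simp_all add: fixed_pair_def algebra_simps scaleR_2)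
  have W1: "s - (x (Suc (Suc (Suc n))) - p) = W" by (simp add: s_def W_def dz_def z_rec)
  have z1: "z (Suc (Suc (Suc n))) - q = (z (Suc (Suc n)) - q) + W" by (simp add: W_def dz_def)
  have "(norm (z (Suc (Suc (Suc n))) - q))\<^sup>2
      \<le> (norm (z (Suc (Suc n)) - q))\<^sup>2 - (norm W)\<^sup>2 - 2 * \<gamma> * (s \<bullet> (E' + D))"
    using splitting_step_estimate[OF \<gamma>_pos A1_monotone[OF x_incl[of "Suc (Suc n)"] inc(2)]
        A2_monotone[OF y_incl[of "Suc n"] inc(1)]]
    unfolding s_def[symmetric] W1 z1 w_def[symmetric]
    by (simp add: E'_def D_def add_diff_add)
  moreover have "- (2 * \<gamma> * (s \<bullet> D)) \<le> \<gamma> / (2 * \<beta>) * (norm Y')\<^sup>2"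
    using cocoercive_estimate[OF \<beta>_pos less_imp_le[OF \<gamma>_pos] Ccoco[of "y (Suc (Suc n))" p], of s]
    by (simp add: s_def D_def Y'_def dy_def)
  moreover have "- (2 * \<gamma> * (s \<bullet> E')) \<le> - (2 * \<gamma> * (Y' \<bullet> E')) + 2 * \<gamma> * (Y \<bullet> E')"
  proof -
    \<comment> \<open>Monotonicity of \<open>B\<close> is available at the extrapolated point
      \<open>w (Suc n)\<close>, not at the new iterate, so \<open>s\<close> is split
      accordingly.\<close>
    have "s = (w (Suc n) - p) + Y' - Y"
      by (simp add: s_def w_def Y'_def Y_def dy_def algebra_simps scaleR_2)
    then have "s \<bullet> E' = (w (Suc n) - p) \<bullet> E' + Y' \<bullet> E' - Y \<bullet> E'" by (simp add: inner_simps)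
    moreover have "0 \<le> (w (Suc n) - p) \<bullet> E'" unfolding E'_def by (rule Bmono)
    ultimately have "\<gamma> * (Y' \<bullet> E' - Y \<bullet> E') \<le> \<gamma> * (s \<bullet> E')" using \<gamma>_pos by (intro mult_left_mono) auto
    then show ?thesis by (simp add: algebra_simps)
  qed
  ultimately have main: "(norm (z (Suc (Suc (Suc n))) - q))\<^sup>2
      \<le> (norm (z (Suc (Suc n)) - q))\<^sup>2 - (norm W)\<^sup>2 + \<gamma> / (2 * \<beta>) * (norm Y')\<^sup>2
        - 2 * \<gamma> * (Y' \<bullet> E') + 2 * \<gamma> * (Y \<bullet> E) + 2 * \<gamma> * (Y \<bullet> G)"
    unfolding inner_add_right[of s] by (simp add: E' inner_add_right distrib_left)
  have W2: "y (Suc (Suc (Suc n))) - y (Suc (Suc n)) - (x (Suc (Suc (Suc n))) - x (Suc (Suc n))) = W - Z"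
    by (simp add: W_def Z_def dz_def z_rec)
  have "(norm W)\<^sup>2 \<le> (norm Z)\<^sup>2 - (norm (W - Z))\<^sup>2 - 2 * \<gamma> * (Y' \<bullet> (G + H))"
    using splitting_step_estimate[OF \<gamma>_pos
        A1_monotone[OF x_incl[of "Suc (Suc n)"] x_incl[of "Suc n"]]
        A2_monotone[OF y_incl[of "Suc n"] y_incl[of n]]]
    unfolding W2 w_def[symmetric]
    by (simp add: G_def H_def add_diff_add Z_def[unfolded dz_def, symmetric] Y'_def[unfolded dy_def, symmetric])
  moreover have "- (2 * \<gamma> * (Y' \<bullet> H)) \<le> \<gamma> / (2 * \<beta>) * (norm (Y' - Y))\<^sup>2"
    using cocoercive_estimate[OF \<beta>_pos less_imp_le[OF \<gamma>_pos]
        Ccoco[of "y (Suc (Suc n))" "y (Suc n)"], of Y']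
    by (simp add: H_def Y_def dy_def)
  ultimately have diff: "(norm W)\<^sup>2 \<le> (norm Z)\<^sup>2 - (norm (W - Z))\<^sup>2 - 2 * \<gamma> * (Y' \<bullet> G)
      + \<gamma> / (2 * \<beta>) * (norm (Y' - Y))\<^sup>2"
    by (simp add: inner_add_right distrib_left)
  \<comment> \<open>Because \<open>diff\<close> counts twice, the factors of \<open>G\<close>
    combine to \<open>2 *\<^sub>R Y' - Y\<close>. The Lipschitz bound of \<open>G\<close> involves
    the same expression one step earlier, so the arithmetic-geometric mean inequality leaves a
    telescoping pair.\<close>
  have lip: "- (4 * \<gamma> * (Y' \<bullet> G)) + 2 * \<gamma> * (Y \<bullet> G)
      \<le> \<gamma> * L * (norm (2 *\<^sub>R Y' - Y))\<^sup>2 + \<gamma> * L * (norm (2 *\<^sub>R Y - Y0))\<^sup>2"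
  proof -
    define a b where "a = norm (2 *\<^sub>R Y' - Y)" and "b = norm (2 *\<^sub>R Y - Y0)"
    have "w (Suc n) - w n = 2 *\<^sub>R Y - Y0"
      by (simp add: w_def Y_def Y0_def dy_def algebra_simps scaleR_2)
    then have "norm G \<le> L * b" using Blip[of "w (Suc n)" "w n"] by (simp add: G_def b_def)
    then have "a * norm G \<le> a * (L * b)" by (simp add: a_def mult_left_mono)
    moreover have "- ((2 *\<^sub>R Y' - Y) \<bullet> G) \<le> a * norm G"
      using Cauchy_Schwarz_ineq2[of "2 *\<^sub>R Y' - Y" G] by (simp add: a_def)
    moreover have "L * (2 * (a * b)) \<le> L * (a\<^sup>2 + b\<^sup>2)"
      using L_nonneg sum_squares_bound[of a b] by (intro mult_left_mono) (auto simp: mult.assoc)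
    ultimately have "- (2 * ((2 *\<^sub>R Y' - Y) \<bullet> G)) \<le> L * (a\<^sup>2 + b\<^sup>2)" by (simp add: algebra_simps)
    then have "\<gamma> * - (2 * ((2 *\<^sub>R Y' - Y) \<bullet> G)) \<le> \<gamma> * (L * (a\<^sup>2 + b\<^sup>2))"
      using \<gamma>_pos by (intro mult_left_mono) auto
    then show ?thesis by (simp add: a_def b_def inner_simps algebra_simps)
  qed
  define P P' Q where "P = 7 * (norm Z)\<^sup>2 - 6 * (Z \<bullet> Y) + 4 * (norm Y)\<^sup>2"
    and "P' = 7 * (norm W)\<^sup>2 - 6 * (W \<bullet> Y') + 4 * (norm Y')\<^sup>2"
    and "Q = (norm (2 *\<^sub>R Y' - Y))\<^sup>2"
  have firm: "(norm X)\<^sup>2 \<le> X \<bullet> Z"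
    using A1_firm[OF x_incl[of "Suc (Suc n)"] x_incl[of "Suc n"]] by (simp add: X_def Z_def dz_def)
  have "\<kappa> * (Q + P') \<le> \<kappa> * (5 * ((norm W)\<^sup>2 + 2 * (norm (W - Z))\<^sup>2) + P)"
    unfolding Q_def P_def P'_def
    by (rule mult_left_mono[OF storage_estimate[OF Y' firm] \<kappa>_bounds(2)])
  then have cert: "\<kappa> * Q + \<kappa> * P'
      \<le> 5 * \<kappa> * (norm W)\<^sup>2 + 2 * (5 * \<kappa> * (norm (W - Z))\<^sup>2) + \<kappa> * P"
    by (simp add: algebra_simps)
  have small: "5 * \<kappa> * (norm (W - Z))\<^sup>2 \<le> (norm (W - Z))\<^sup>2"
    using \<kappa>_bounds(1) by (simp add: mult_le_cancel_right2)
  \<comment> \<open>This identity turns the two errors of \<open>C\<close> into a multiple of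
    \<open>Q\<close> and a telescoping difference.\<close>
  have "(norm Y')\<^sup>2 + 2 * (norm (Y' - Y))\<^sup>2 = Q - (norm Y')\<^sup>2 + (norm Y)\<^sup>2"
    unfolding Q_def power2_norm_eq_inner by (simp add: inner_simps inner_commute)
  then have "\<gamma> / (2 * \<beta>) * ((norm Y')\<^sup>2 + 2 * (norm (Y' - Y))\<^sup>2)
      = \<gamma> / (2 * \<beta>) * (Q - (norm Y')\<^sup>2 + (norm Y)\<^sup>2)" by simp
  then have filt: "\<gamma> / (2 * \<beta>) * (norm Y')\<^sup>2 + 2 * (\<gamma> / (2 * \<beta>) * (norm (Y' - Y))\<^sup>2)
      = \<gamma> / (2 * \<beta>) * Q - \<gamma> / (2 * \<beta>) * (norm Y')\<^sup>2 + \<gamma> / (2 * \<beta>) * (norm Y)\<^sup>2"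
    by (simp only: distrib_left right_diff_distrib)
  have kQ: "\<kappa> * Q = \<gamma> / (2 * \<beta>) * Q + 2 * (\<gamma> * L * Q)" by (simp add: \<kappa>_def distrib_right)
  have V0: "V p q n = (norm (z (Suc (Suc n)) - q))\<^sup>2 + 2 * (norm Z)\<^sup>2 + 2 * \<gamma> * (Y \<bullet> E)
     + \<gamma> / (2 * \<beta>) * (norm Y)\<^sup>2 + \<gamma> * L * (norm (2 *\<^sub>R Y - Y0))\<^sup>2 + \<kappa> * P"
    unfolding V_def P_def defs E_def ..
  have V1: "V p q (Suc n) = (norm (z (Suc (Suc (Suc n))) - q))\<^sup>2 + 2 * (norm W)\<^sup>2
     + 2 * \<gamma> * (Y' \<bullet> E') + \<gamma> / (2 * \<beta>) * (norm Y')\<^sup>2 + \<gamma> * L * Q + \<kappa> * P'"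
    unfolding V_def P'_def Q_def defs E'_def ..
  have lip': "- 2 * (2 * \<gamma> * (Y' \<bullet> G)) + 2 * \<gamma> * (Y \<bullet> G)
      \<le> \<gamma> * L * Q + \<gamma> * L * (norm (2 *\<^sub>R Y - Y0))\<^sup>2"
    using lip by (simp add: Q_def)
  have "V p q (Suc n) \<le> V p q n - (norm W)\<^sup>2 + 5 * \<kappa> * (norm W)\<^sup>2"
    unfolding V0 V1 using main diff lip' cert small filt kQ by linarith
  then show ?thesis by (simp add: W_def algebra_simps)
qed

text \<open>Only the pairing with \<open>B\<close> and the mixed product can be negative.
  Nonexpansiveness in \<open>A1\<close> bounds \<open>w n - p\<close> by the norms \<zeta>,
  \<open>e\<close>, \<open>d\<close>, \<open>f\<close>, which reduces the claim to
  \<open>lyapunov_lower_estimate\<close> with \<open>\<gamma> * L\<close> for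
  \<open>l\<close>.\<close>

lemma V_lower:
  assumes pq: "fixed_pair p q"
  shows "(norm (z (Suc (Suc n)) - q))\<^sup>2 / 2 \<le> V p q n"
proof -
  define \<zeta> e d f where "\<zeta> = norm (z (Suc (Suc n)) - q)" and "e = norm (dz (Suc n))"
    and "d = norm (dy (Suc n))" and "f = norm (2 *\<^sub>R dy (Suc n) - dy n)"
  have inc: "(1 / \<gamma>) *\<^sub>R (q - p) \<in> A1 p" using pq by (simp add: fixed_pair_def)
  have "norm (x (Suc (Suc n)) - p) \<le> norm (z (Suc n) - q)"
    by (rule A1_nonexpansive[OF x_incl inc])
  also have "\<dots> = norm ((z (Suc (Suc n)) - q) - dz (Suc n))" by (simp add: dz_def)
  also have "\<dots> \<le> \<zeta> + e" unfolding \<zeta>_def e_def by (rule norm_triangle_ineq4)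
  finally have x: "norm (x (Suc (Suc n)) - p) \<le> \<zeta> + e" .
  have "w n - p = (x (Suc (Suc n)) - p) + dz (Suc n) + dy (Suc n) - (2 *\<^sub>R dy (Suc n) - dy n)"
  proof -
    have "w n = y (Suc (Suc n)) + dy (Suc n) - (2 *\<^sub>R dy (Suc n) - dy n)"
      by (simp add: w_def dy_def algebra_simps scaleR_2)
    then show ?thesis by (simp add: y_eq[of "Suc n"])
  qed
  then have "norm (w n - p) \<le> \<zeta> + e + e + d + f"
    using x unfolding e_def d_def f_def
    by (smt (verit) norm_triangle_ineq norm_triangle_ineq4)
  then have "L * norm (w n - p) \<le> L * (\<zeta> + 2 * e + d + f)" using L_nonneg by (simp add: mult_left_mono)
  then have "norm (B (w n) - B p) \<le> L * (\<zeta> + 2 * e + d + f)" using Blip order_trans by blast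
  then have "d * norm (B (w n) - B p) \<le> d * (L * (\<zeta> + 2 * e + d + f))"
    by (simp add: d_def mult_left_mono)
  moreover have "- (dy (Suc n) \<bullet> (B (w n) - B p)) \<le> d * norm (B (w n) - B p)"
    using Cauchy_Schwarz_ineq2[of "dy (Suc n)" "B (w n) - B p"] by (simp add: d_def)
  ultimately have "2 * \<gamma> * - (dy (Suc n) \<bullet> (B (w n) - B p)) \<le> 2 * \<gamma> * (d * (L * (\<zeta> + 2 * e + d + f)))"
    using \<gamma>_pos by (intro mult_left_mono) auto
  then have T: "- (2 * (\<gamma> * L) * (d * (\<zeta> + 2 * e + d + f))) \<le> 2 * \<gamma> * (dy (Suc n) \<bullet> (B (w n) - B p))"
    by (simp add: algebra_simps)
  have "dz (Suc n) \<bullet> dy (Suc n) \<le> e * d" unfolding e_def d_def by (rule norm_cauchy_schwarz)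
  then have P: "\<kappa> * (7 * e\<^sup>2 - 6 * (e * d) + 4 * d\<^sup>2) \<le> \<kappa> * (7 * e\<^sup>2 - 6 * (dz (Suc n) \<bullet> dy (Suc n)) + 4 * d\<^sup>2)"
    using \<kappa>_bounds(2) by (intro mult_left_mono) auto
  have nn: "0 \<le> \<gamma> / (2 * \<beta>) * d\<^sup>2" "0 \<le> 2 * e\<^sup>2" using \<gamma>_pos \<beta>_pos by auto
  have "\<zeta>\<^sup>2 / 2 \<le> \<zeta>\<^sup>2 + \<gamma> * L * f\<^sup>2 + \<kappa> * (7 * e\<^sup>2 - 6 * (e * d) + 4 * d\<^sup>2)
    - 2 * (\<gamma> * L) * (d * (\<zeta> + 2 * e + d + f))"
    by (rule lyapunov_lower_estimate)
      (use \<kappa>_bounds \<gamma>_pos L_nonneg in \<open>auto simp: e_def d_def\<close>)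
  then show ?thesis using T P nn unfolding V_def \<zeta>_def[symmetric] e_def[symmetric] d_def[symmetric] f_def[symmetric]
    by linarith
qed

section \<open>Weak convergence of the iteration\<close>

text \<open>\<open>V p q\<close> is nonincreasing and nonnegative, hence convergent, and its
  vanishing decrements control \<open>dz\<close>; \<open>dy\<close> follows by nonexpansiveness. All
  summands of \<open>V\<close> except the first then vanish, the pairing with \<open>B\<close>
  because \<open>w\<close> stays bounded, so the squared distance inherits the limit of
  \<open>V\<close>.\<close>

lemma fixed_pair_asymptotics:
  assumes pq: "fixed_pair p q"
  shows "dz \<longlonglongrightarrow> 0" "dy \<longlonglongrightarrow> 0" "convergent (\<lambda>n. (norm (z n - q))\<^sup>2)"
    "\<exists>M. \<forall>n. norm (z n) \<le> M \<and> norm (x (Suc n)) \<le> M"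
proof -
  have dec: "V p q (Suc n) \<le> V p q n" for n
    using V_decreasing[OF pq, of n] mult_nonneg_nonneg[OF less_imp_le[OF \<kappa>_bounds(1)] zero_le_power2]
    by (smt (verit))
  have pos: "0 \<le> V p q n" for n
    using V_lower[OF pq, of n] zero_le_power2[of "norm (z (Suc (Suc n)) - q)"] by linarith
  have decV: "decseq (V p q)" using dec by (simp add: decseq_SucI)
  then obtain v where v: "V p q \<longlonglongrightarrow> v" using decseq_convergent[of "V p q" 0] pos by blast
  have "(\<lambda>n. (V p q n - V p q (Suc n)) / (1 - 5 * \<kappa>)) \<longlonglongrightarrow> (v - v) / (1 - 5 * \<kappa>)"
    using \<kappa>_bounds(1) by (intro tendsto_intros v LIMSEQ_Suc) auto
  then have "(\<lambda>n. (V p q n - V p q (Suc n)) / (1 - 5 * \<kappa>)) \<longlonglongrightarrow> 0" by simp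
  then have "(\<lambda>n. (norm (dz (Suc (Suc n))))\<^sup>2) \<longlonglongrightarrow> 0"
  proof (rule Lim_null_comparison[rotated])
    have "(norm (dz (Suc (Suc n))))\<^sup>2 \<le> (V p q n - V p q (Suc n)) / (1 - 5 * \<kappa>)" for n
      using V_decreasing[OF pq, of n] \<kappa>_bounds(1) by (simp add: pos_le_divide_eq mult.commute)
    then show "\<forall>\<^sub>F n in sequentially. norm ((norm (dz (Suc (Suc n))))\<^sup>2)
        \<le> (V p q n - V p q (Suc n)) / (1 - 5 * \<kappa>)" by simp
  qed
  then have "(\<lambda>n. sqrt ((norm (dz (Suc (Suc n))))\<^sup>2)) \<longlonglongrightarrow> sqrt 0" by (rule tendsto_real_sqrt)
  then have "(\<lambda>n. dz (Suc (Suc n))) \<longlonglongrightarrow> 0" by (simp add: tendsto_norm_zero_iff)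
  then have dz0: "dz \<longlonglongrightarrow> 0"
    using LIMSEQ_imp_Suc[of "\<lambda>n. dz (Suc n)"] LIMSEQ_imp_Suc[of dz] by blast
  have "(\<lambda>n. dy (Suc n)) \<longlonglongrightarrow> 0"
  proof (rule Lim_null_comparison)
    have "norm (dy (Suc n)) \<le> norm (dz (Suc n)) + 2 * norm (dz n)" for n
    proof -
      have "norm (x (Suc (Suc n)) - x (Suc n)) \<le> norm (dz n)"
        unfolding dz_def by (rule A1_nonexpansive[OF x_incl x_incl])
      then show ?thesis unfolding dy_eq by (smt (verit) norm_triangle_ineq norm_triangle_ineq4)
    qed
    then show "\<forall>\<^sub>F n in sequentially. norm (dy (Suc n)) \<le> norm (dz (Suc n)) + 2 * norm (dz n)" by simp
    have "(\<lambda>n. norm (dz (Suc n)) + 2 * norm (dz n)) \<longlonglongrightarrow> norm (0::'a) + 2 * norm (0::'a)"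
      by (intro tendsto_intros dz0 LIMSEQ_Suc)
    then show "(\<lambda>n. norm (dz (Suc n)) + 2 * norm (dz n)) \<longlonglongrightarrow> 0" by simp
  qed
  then have dy0: "dy \<longlonglongrightarrow> 0" by (rule LIMSEQ_imp_Suc[of dy])
  \<comment> \<open>\<open>V_lower\<close> reaches only indices from \<open>2\<close> on; the first
    two distances are added by hand.\<close>
  define R where "R = Max {norm (z 0 - q), norm (z 1 - q), sqrt (2 * V p q 0)}"
  have zR: "norm (z n - q) \<le> R" for n
  proof -
    consider "n = 0" | "n = 1" | m where "n = Suc (Suc m)" by (metis One_nat_def not0_implies_Suc)
    then show ?thesis
    proof cases
      case 3
      have "(norm (z n - q))\<^sup>2 \<le> 2 * V p q 0"
        using V_lower[OF pq, of m] decseqD[OF decV, of 0 m] 3 by simp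
      then have "norm (z n - q) \<le> sqrt (2 * V p q 0)" by (rule real_le_rsqrt)
      then show ?thesis by (auto simp: R_def intro: order_trans)
    qed (auto simp: R_def)
  qed
  have inc: "(1 / \<gamma>) *\<^sub>R (q - p) \<in> A1 p" using pq by (simp add: fixed_pair_def)
  have xR: "norm (x (Suc n) - p) \<le> R" for n
    using A1_nonexpansive[OF x_incl inc] zR order_trans by blast
  have "norm (y (Suc (Suc n)) - p) \<le> 3 * R" for n
  proof -
    have "norm (dz (Suc n)) \<le> R + R"
      using norm_triangle_ineq4[of "z (Suc (Suc n)) - q" "z (Suc n) - q"] zR[of "Suc (Suc n)"] zR[of "Suc n"]
      by (simp add: dz_def)
    then show ?thesis
      using norm_triangle_ineq[of "x (Suc (Suc n)) - p" "dz (Suc n)"] xR[of "Suc n"]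
      by (simp add: y_eq[of "Suc n"] algebra_simps)
  qed
  then have wR: "norm (w (Suc (Suc n)) - p) \<le> 9 * R" for n
  proof -
    have "w (Suc (Suc n)) - p = (y (Suc (Suc (Suc n))) - p) + (y (Suc (Suc (Suc n))) - p) - (y (Suc (Suc n)) - p)"
      by (simp add: w_def scaleR_2 algebra_simps)
    then show ?thesis
      using \<open>\<And>n. norm (y (Suc (Suc n)) - p) \<le> 3 * R\<close>[of n]
        \<open>\<And>n. norm (y (Suc (Suc n)) - p) \<le> 3 * R\<close>[of "Suc n"]
      by (smt (verit) norm_triangle_ineq norm_triangle_ineq4)
  qed
  have BwR: "norm (B (w (Suc (Suc n))) - B p) \<le> L * (9 * R)" for n
    using order_trans[OF Blip mult_left_mono[OF wR L_nonneg]] .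
  have "(\<lambda>n. (B (w (Suc (Suc n))) - B p) \<bullet> dy (Suc (Suc (Suc n)))) \<longlonglongrightarrow> 0"
    by (rule tendsto_inner_bounded_null[OF BwR]) (intro LIMSEQ_Suc dy0)
  then have Bdy: "(\<lambda>n. dy (Suc (Suc (Suc n))) \<bullet> (B (w (Suc (Suc n))) - B p)) \<longlonglongrightarrow> 0"
    by (simp add: inner_commute)
  have dz3: "(\<lambda>n. dz (Suc (Suc (Suc n)))) \<longlonglongrightarrow> 0" by (intro LIMSEQ_Suc dz0)
  have dy3: "(\<lambda>n. dy (Suc (Suc (Suc n)))) \<longlonglongrightarrow> 0" and dy2: "(\<lambda>n. dy (Suc (Suc n))) \<longlonglongrightarrow> 0"
    by (intro LIMSEQ_Suc dy0)+
  have t1: "(\<lambda>n. 2 * (norm (dz (Suc (Suc (Suc n)))))\<^sup>2) \<longlonglongrightarrow> 0"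
    by (rule tendsto_eq_intros dz3 refl)+ simp
  have t2: "(\<lambda>n. 2 * \<gamma> * (dy (Suc (Suc (Suc n))) \<bullet> (B (w (Suc (Suc n))) - B p))) \<longlonglongrightarrow> 0"
    using tendsto_mult[OF tendsto_const Bdy] by simp
  have t3: "(\<lambda>n. \<gamma> / (2 * \<beta>) * (norm (dy (Suc (Suc (Suc n)))))\<^sup>2) \<longlonglongrightarrow> 0"
    using tendsto_mult[OF tendsto_const[of "\<gamma> / (2 * \<beta>)"] tendsto_power[OF tendsto_norm[OF dy3], of 2]]
    by simp
  have t4: "(\<lambda>n. \<gamma> * L * (norm (2 *\<^sub>R dy (Suc (Suc (Suc n))) - dy (Suc (Suc n))))\<^sup>2) \<longlonglongrightarrow> 0"
    by (rule tendsto_eq_intros dy3 dy2 refl)+ simp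
  have t5: "(\<lambda>n. \<kappa> * (7 * (norm (dz (Suc (Suc (Suc n)))))\<^sup>2 - 6 * (dz (Suc (Suc (Suc n))) \<bullet> dy (Suc (Suc (Suc n))))
        + 4 * (norm (dy (Suc (Suc (Suc n)))))\<^sup>2)) \<longlonglongrightarrow> 0"
    by (rule tendsto_eq_intros dz3 dy3 refl)+ simp
  have "(\<lambda>n. (norm (z (Suc (Suc (Suc (Suc n)))) - q))\<^sup>2) \<longlonglongrightarrow> v"
    using tendsto_diff[OF LIMSEQ_Suc[OF LIMSEQ_Suc[OF v]]
        tendsto_add[OF tendsto_add[OF tendsto_add[OF tendsto_add[OF t1 t2] t3] t4] t5]]
    by (simp add: V_def)
  then have "(\<lambda>n. (norm (z n - q))\<^sup>2) \<longlonglongrightarrow> v"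
    using LIMSEQ_imp_Suc[of "\<lambda>n. (norm (z n - q))\<^sup>2" v] LIMSEQ_imp_Suc[of "\<lambda>n. (norm (z (Suc n) - q))\<^sup>2" v]
      LIMSEQ_imp_Suc[of "\<lambda>n. (norm (z (Suc (Suc n)) - q))\<^sup>2" v]
      LIMSEQ_imp_Suc[of "\<lambda>n. (norm (z (Suc (Suc (Suc n))) - q))\<^sup>2" v] by blast
  then have conv: "convergent (\<lambda>n. (norm (z n - q))\<^sup>2)" by (rule convergentI)
  have "norm (z n) \<le> R + norm p + norm q" for n
    using zR[of n] norm_triangle_sub[of "z n" q] norm_ge_zero[of p] by linarith
  moreover have "norm (x (Suc n)) \<le> R + norm p + norm q" for n
    using xR[of n] norm_triangle_sub[of "x (Suc n)" p] norm_ge_zero[of q] by linarith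
  ultimately show "\<exists>M. \<forall>n. norm (z n) \<le> M \<and> norm (x (Suc n)) \<le> M" by blast
  show "dz \<longlonglongrightarrow> 0" "dy \<longlonglongrightarrow> 0" "convergent (\<lambda>n. (norm (z n - q))\<^sup>2)"
    by (fact dz0 dy0 conv)+
qed

text \<open>Summing the two monotonicity inequalities makes the products of weakly convergent sequences cancel.
  In the limit a sum of two independent expressions is nonnegative, and maximality forces each
  of them to be nonnegative.\<close>
lemma weak_cluster_point_fixed_pair:
  assumes dz0: "dz \<longlonglongrightarrow> 0" and dy0: "dy \<longlonglongrightarrow> 0"
    and zM: "\<And>n. norm (z n) \<le> M" and xM: "\<And>n. norm (x (Suc n)) \<le> M"
    and r: "strict_mono r"
    and zr: "weakly_converges (\<lambda>n. z (Suc (r n))) q"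
    and xr: "weakly_converges (\<lambda>n. x (Suc (Suc (r n)))) p"
  shows "fixed_pair p q"
proof -
  define \<epsilon> where "\<epsilon> n = B (y (Suc (Suc n))) - B (w n) + (C (y (Suc (Suc n))) - C (y (Suc n)))" for n
  define a where "a n = (1 / \<gamma>) *\<^sub>R (z (Suc n) - x (Suc (Suc n)))" for n
  \<comment> \<open>Residual of the inclusion for \<open>A2\<close> after \<open>B\<close> and
    \<open>C\<close> are moved to the new point \<open>y (Suc (Suc n))\<close>; it tends to
    \<open>0\<close> strongly.\<close>
  define \<eta> where "\<eta> n = \<epsilon> n - (1 / \<gamma>) *\<^sub>R dz (Suc n)" for n
  define abar where "abar = (1 / \<gamma>) *\<^sub>R (q - p)"
  have "\<epsilon> \<longlonglongrightarrow> 0"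
  proof (rule Lim_null_comparison)
    have "norm (\<epsilon> n) \<le> L * norm (dy (Suc n) - dy n) + 1 / \<beta> * norm (dy (Suc n))" for n
    proof -
      have "y (Suc (Suc n)) - w n = dy (Suc n) - dy n" by (simp add: w_def dy_def scaleR_2 algebra_simps)
      then show ?thesis
        unfolding \<epsilon>_def using Blip[of "y (Suc (Suc n))" "w n"] C_lipschitz[of "y (Suc (Suc n))" "y (Suc n)"]
        unfolding dy_def[symmetric] by (metis norm_triangle_ineq add_mono order_trans)
    qed
    then show "\<forall>\<^sub>F n in sequentially. norm (\<epsilon> n) \<le> L * norm (dy (Suc n) - dy n) + 1 / \<beta> * norm (dy (Suc n))"
      by simp
    have "(\<lambda>n. L * norm (dy (Suc n) - dy n) + 1 / \<beta> * norm (dy (Suc n)))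
        \<longlonglongrightarrow> L * norm ((0::'a) - 0) + 1 / \<beta> * norm (0::'a)"
      by (intro tendsto_intros LIMSEQ_Suc dy0)
    then show "(\<lambda>n. L * norm (dy (Suc n) - dy n) + 1 / \<beta> * norm (dy (Suc n))) \<longlonglongrightarrow> 0" by simp
  qed
  then have "(\<lambda>n. \<epsilon> n - (1 / \<gamma>) *\<^sub>R dz (Suc n)) \<longlonglongrightarrow> 0 - (1 / \<gamma>) *\<^sub>R 0"
    by (intro tendsto_intros LIMSEQ_Suc dz0)
  then have \<eta>0: "\<eta> \<longlonglongrightarrow> 0" by (simp add: \<eta>_def[abs_def])
  have xM': "norm (x (Suc (Suc n))) \<le> M" for n by (rule xM)
  have aM: "norm (a n) \<le> 1 / \<gamma> * (M + M)" for n
  proof -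
    have "norm (z (Suc n) - x (Suc (Suc n))) \<le> M + M"
      using norm_triangle_ineq4[of "z (Suc n)" "x (Suc (Suc n))"] zM[of "Suc n"] xM'[of n] by linarith
    then show ?thesis using \<gamma>_pos by (simp add: a_def divide_right_mono)
  qed
  have key: "0 \<le> (p' - p) \<bullet> (u - abar) + (q' - p) \<bullet> (v + (B q' + C q') + abar)"
    if u: "u \<in> A1 p'" and v: "v \<in> A2 q'" for p' u q' v
  proof -
    define v' where "v' = v + (B q' + C q')"
    \<comment> \<open>The sum of both products after cancelling
      \<open>x (Suc (Suc n)) \<bullet> a n\<close>. Each remaining pairing has a fixed vector or a
      strongly vanishing factor, so weak limits suffice.\<close>
    define \<phi> where "\<phi> n = x (Suc (Suc n)) \<bullet> \<eta> n + dz (Suc n) \<bullet> \<eta> n - a n \<bullet> dz (Suc n)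
       - a n \<bullet> p' - x (Suc (Suc n)) \<bullet> u + p' \<bullet> u - q' \<bullet> \<eta> n + a n \<bullet> q'
       - x (Suc (Suc n)) \<bullet> v' - dz (Suc n) \<bullet> v' + q' \<bullet> v'" for n
    have \<phi>_nonneg: "0 \<le> \<phi> n" for n
    proof -
      have 1: "0 \<le> (x (Suc (Suc n)) - p') \<bullet> (a n - u)"
        unfolding a_def by (rule monotone_opD[OF maximal_monotone_imp_monotone[OF A1] x_incl u])
      define b where "b = (1 / \<gamma>) *\<^sub>R (2 *\<^sub>R x (Suc (Suc n)) - z (Suc n) - y (Suc (Suc n)))
        - (B (w n) + C (y (Suc n)))"
      let ?y = "y (Suc (Suc n))"
      have "0 \<le> (?y - q') \<bullet> (b - v)" unfolding b_def w_def
        by (rule monotone_opD[OF maximal_monotone_imp_monotone[OF A2] y_incl v])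
      moreover have "0 \<le> (?y - q') \<bullet> (B ?y - B q')" by (rule Bmono)
      moreover have "0 \<le> (?y - q') \<bullet> (C ?y - C q')"
        using Ccoco[of ?y q'] \<beta>_pos by (smt (verit) mult_nonneg_nonneg zero_le_power2)
      ultimately have "0 \<le> (?y - q') \<bullet> ((b - v) + (B ?y - B q') + (C ?y - C q'))"
        unfolding inner_add_right by linarith
      also have "(b - v) + (B ?y - B q') + (C ?y - C q') = \<eta> n - a n - v'"
        by (simp add: b_def v'_def \<eta>_def \<epsilon>_def a_def y_eq[of "Suc n"] algebra_simps scaleR_2)
      finally have 2: "0 \<le> (?y - q') \<bullet> (\<eta> n - a n - v')" .
      have "(x (Suc (Suc n)) - p') \<bullet> (a n - u) + (?y - q') \<bullet> (\<eta> n - a n - v') = \<phi> n"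
        unfolding \<phi>_def y_eq[of "Suc n"] by (simp add: inner_simps inner_commute)
      with 1 2 show ?thesis by linarith
    qed
    have sub: "(\<lambda>n. f (r n)) \<longlonglongrightarrow> l" if "f \<longlonglongrightarrow> l" for f :: "nat \<Rightarrow> real" and l
      using LIMSEQ_subseq_LIMSEQ[OF that r] by (simp add: o_def)
    have x\<eta>: "(\<lambda>n. x (Suc (Suc n)) \<bullet> \<eta> n) \<longlonglongrightarrow> 0"
      by (rule tendsto_inner_bounded_null[OF xM' \<eta>0])
    have adz: "(\<lambda>n. a n \<bullet> dz (Suc n)) \<longlonglongrightarrow> 0"
      by (rule tendsto_inner_bounded_null[OF aM LIMSEQ_Suc[OF dz0]])
    have dz\<eta>: "(\<lambda>n. dz (Suc n) \<bullet> \<eta> n) \<longlonglongrightarrow> 0"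
      using tendsto_inner[OF LIMSEQ_Suc[OF dz0] \<eta>0] by simp
    have dzv: "(\<lambda>n. dz (Suc n) \<bullet> v') \<longlonglongrightarrow> 0"
      using tendsto_inner[OF LIMSEQ_Suc[OF dz0] tendsto_const] by simp
    have q\<eta>: "(\<lambda>n. q' \<bullet> \<eta> n) \<longlonglongrightarrow> 0"
      using tendsto_inner[OF tendsto_const \<eta>0] by simp
    have xw: "(\<lambda>n. x (Suc (Suc (r n))) \<bullet> h) \<longlonglongrightarrow> p \<bullet> h" for h
      using xr by (simp add: weakly_converges_def)
    have aw: "(\<lambda>n. a (r n) \<bullet> h) \<longlonglongrightarrow> abar \<bullet> h" for h
    proof -
      have "(\<lambda>n. (1 / \<gamma>) * (z (Suc (r n)) \<bullet> h - x (Suc (Suc (r n))) \<bullet> h)) \<longlonglongrightarrow> (1 / \<gamma>) * (q \<bullet> h - p \<bullet> h)"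
        using zr xw[of h] by (intro tendsto_mult tendsto_const tendsto_diff) (simp_all add: weakly_converges_def)
      then show ?thesis by (simp add: a_def abar_def inner_diff_left)
    qed
    have "(\<lambda>n. \<phi> (r n)) \<longlonglongrightarrow> 0 + 0 - 0 - abar \<bullet> p' - p \<bullet> u + p' \<bullet> u - 0 + abar \<bullet> q' - p \<bullet> v' - 0 + q' \<bullet> v'"
      unfolding \<phi>_def by (intro tendsto_add tendsto_diff tendsto_const sub[OF x\<eta>] sub[OF adz] sub[OF dz\<eta>] sub[OF dzv] sub[OF q\<eta>] xw aw)
    then have "0 \<le> 0 + 0 - 0 - abar \<bullet> p' - p \<bullet> u + p' \<bullet> u - 0 + abar \<bullet> q' - p \<bullet> v' - 0 + q' \<bullet> v'"
      by (rule LIMSEQ_le_const) (use \<phi>_nonneg in auto)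
    then show ?thesis unfolding v'_def[symmetric] by (simp add: inner_simps inner_commute)
  qed
  have max2: "- abar - (B p + C p) \<in> A2 p"
    if "\<And>q' v. v \<in> A2 q' \<Longrightarrow> 0 \<le> (q' - p) \<bullet> (v + (B q' + C q') + abar)"
  proof (rule maximal_monotone_add_lipschitz[OF A2, where c = "L + 1 / \<beta>"])
    fix s t
    have "norm (B s + C s - (B t + C t)) \<le> norm (B s - B t) + norm (C s - C t)"
      unfolding add_diff_add by (rule norm_triangle_ineq)
    then show "norm (B s + C s - (B t + C t)) \<le> (L + 1 / \<beta>) * norm (s - t)"
      using Blip[of s t] C_lipschitz[of s t] by (simp add: distrib_right)
  qed (use that in simp)
  \<comment> \<open>A violating graph point of \<open>A1\<close> makes the first product in
    \<open>key\<close> negative, so the second is positive throughout and \<open>max2\<close>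
    applies. The resulting element of \<open>A2 p\<close> makes the second product \<open>0\<close>,
    a contradiction.\<close>
  have A1p: "abar \<in> A1 p"
  proof (rule ccontr)
    assume "abar \<notin> A1 p"
    then obtain p' u where pu: "u \<in> A1 p'" "(p - p') \<bullet> (abar - u) < 0"
      using maximal_monotone_memI[OF A1, of p abar] by force
    have neg: "(p' - p) \<bullet> (u - abar) < 0" using pu(2) by (simp add: inner_simps)
    then have "- abar - (B p + C p) \<in> A2 p"
      using key[OF pu(1)] by (intro max2) (smt (verit))
    from key[OF pu(1) this] neg show False by simp
  qed
  have "- abar - (B p + C p) \<in> A2 p"
    using key[OF A1p] by (intro max2) simp
  moreover have "- abar = (1 / \<gamma>) *\<^sub>R (p - q)"
    by (simp add: abar_def scaleR_diff_right)
  ultimately show ?thesis using A1p by (simp add: fixed_pair_def abar_def)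
qed

lemma fixed_pair_resolvent: "fixed_pair p q \<Longrightarrow> p = resolvent \<gamma> A1 q"
  using resolvent_eq[OF maximal_monotone_imp_monotone[OF A1] \<gamma>_pos, of "(1 / \<gamma>) *\<^sub>R (q - p)" p q] \<gamma>_pos
  by (simp add: fixed_pair_def)

lemma fixed_pair_zer4: "fixed_pair p q \<Longrightarrow> p \<in> zer4 A1 A2 B C"
  unfolding zer4_def fixed_pair_def mem_Collect_eq
  by (intro bexI[of _ "(1 / \<gamma>) *\<^sub>R (q - p)"] bexI[of _ "(1 / \<gamma>) *\<^sub>R (p - q) - (B p + C p)"])
    (auto simp: scaleR_diff_right)

text \<open>Opial's argument, run on the pairs \<open>s n\<close>: the \<open>z\<close>-parts of two
  cluster points coincide, and the \<open>x\<close>-parts are their resolvents. The limit of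
  \<open>y\<close> is that of \<open>x\<close> because \<open>dz\<close> vanishes.\<close>

theorem weak_convergence:
  assumes "fixed_pair p\<^sub>0 q\<^sub>0"
  obtains p q where "fixed_pair p q" "weakly_converges z q" "weakly_converges x p" "weakly_converges y p"
proof -
  note dz0 = fixed_pair_asymptotics(1)[OF assms] and dy0 = fixed_pair_asymptotics(2)[OF assms]
  obtain M where zM: "\<And>n. norm (z n) \<le> M" and xM: "\<And>n. norm (x (Suc n)) \<le> M"
    using fixed_pair_asymptotics(4)[OF assms] by blast
  \<comment> \<open>In the product space one subsequence serves both components. The offsets match
    because \<open>x (Suc (Suc n))\<close> is computed from \<open>z (Suc n)\<close>.\<close>
  define s where "s n = (z (Suc n), x (Suc (Suc n)))" for n
  have s_fst: "weakly_converges (\<lambda>n. z (Suc (r n))) (fst l)"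
    and s_snd: "weakly_converges (\<lambda>n. x (Suc (Suc (r n)))) (snd l)"
    if "weakly_converges (s \<circ> r) l" for r l
  proof -
    have lim: "(\<lambda>n. s (r n) \<bullet> h) \<longlonglongrightarrow> l \<bullet> h" for h
      using that unfolding weakly_converges_def o_def by blast
    show "weakly_converges (\<lambda>n. z (Suc (r n))) (fst l)" unfolding weakly_converges_def
      using lim[of "(h, 0)" for h] by (simp add: s_def inner_prod_def)
    show "weakly_converges (\<lambda>n. x (Suc (Suc (r n)))) (snd l)" unfolding weakly_converges_def
      using lim[of "(0, h)" for h] by (simp add: s_def inner_prod_def)
  qed
  have fp: "fixed_pair (snd l) (fst l)" if "strict_mono r" "weakly_converges (s \<circ> r) l" for r l
    by (rule weak_cluster_point_fixed_pair[OF dz0 dy0 zM xM that(1) s_fst[OF that(2)] s_snd[OF that(2)]])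
  have "norm (s n) \<le> M + M" for n
    using norm_Pair_le[of "z (Suc n)" "x (Suc (Suc n))"] zM[of "Suc n"] xM[of "Suc n"] by (simp add: s_def)
  then obtain l where l: "weakly_converges s l"
  proof (rule weakly_converges_if_unique_cluster_point)
    fix r r' l l'
    assume r: "strict_mono r" "weakly_converges (s \<circ> r) l"
      and r': "strict_mono r'" "weakly_converges (s \<circ> r') l'"
    define q q' where "q = fst l" and "q' = fst l'"
    have "convergent (\<lambda>n. (norm (z n - q))\<^sup>2)" "convergent (\<lambda>n. (norm (z n - q'))\<^sup>2)"
      unfolding q_def q'_def
      by (rule fixed_pair_asymptotics(3)[OF fp[OF r]], rule fixed_pair_asymptotics(3)[OF fp[OF r']])
    \<comment> \<open>Polarization: the difference of the squared distances is affine in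
      \<open>z n\<close>.\<close>
    then have "convergent (\<lambda>n. (1/2) * ((norm (z n - q'))\<^sup>2 - (norm (z n - q))\<^sup>2 + (norm q)\<^sup>2 - (norm q')\<^sup>2))"
      by (intro convergent_mult convergent_add convergent_diff convergent_const)
    moreover have "(1/2) * ((norm (z n - q'))\<^sup>2 - (norm (z n - q))\<^sup>2 + (norm q)\<^sup>2 - (norm q')\<^sup>2) = z n \<bullet> (q - q')" for n
      unfolding power2_norm_eq_inner by (simp add: inner_simps inner_commute)
    ultimately obtain c where "(\<lambda>n. z n \<bullet> (q - q')) \<longlonglongrightarrow> c" by (auto simp: convergent_def)
    then have c: "(\<lambda>n. z (Suc n) \<bullet> (q - q')) \<longlonglongrightarrow> c" by (rule LIMSEQ_Suc)
    have "(\<lambda>n. z (Suc (r n)) \<bullet> (q - q')) \<longlonglongrightarrow> q \<bullet> (q - q')"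
      using s_fst[OF r(2)] by (simp add: weakly_converges_def q_def)
    then have "c = q \<bullet> (q - q')"
      using LIMSEQ_unique LIMSEQ_subseq_LIMSEQ[OF c r(1)] by (fastforce simp: o_def)
    moreover have "(\<lambda>n. z (Suc (r' n)) \<bullet> (q - q')) \<longlonglongrightarrow> q' \<bullet> (q - q')"
      using s_fst[OF r'(2)] by (simp add: weakly_converges_def q'_def)
    then have "c = q' \<bullet> (q - q')"
      using LIMSEQ_unique LIMSEQ_subseq_LIMSEQ[OF c r'(1)] by (fastforce simp: o_def)
    ultimately have "(q - q') \<bullet> (q - q') = 0" by (simp add: inner_diff_left)
    then have "q = q'" by simp
    moreover have "snd l = snd l'"
      using fixed_pair_resolvent[OF fp[OF r]] fixed_pair_resolvent[OF fp[OF r']] \<open>q = q'\<close>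
      by (simp add: q_def q'_def)
    ultimately show "l = l'" by (simp add: q_def q'_def prod_eq_iff)
  qed
  then have lid: "weakly_converges (s \<circ> id) l" by simp
  have fpl: "fixed_pair (snd l) (fst l)" by (rule fp[OF _ lid]) (simp add: strict_mono_def)
  have zc: "weakly_converges z (fst l)"
    using s_fst[OF lid] unfolding weakly_converges_def id_def by (auto intro: LIMSEQ_imp_Suc)
  have x2: "(\<lambda>n. x (Suc (Suc n)) \<bullet> h) \<longlonglongrightarrow> snd l \<bullet> h" for h
    using s_snd[OF lid] by (simp add: weakly_converges_def)
  have x1: "(\<lambda>n. x (Suc n) \<bullet> h) \<longlonglongrightarrow> snd l \<bullet> h" for h
    using x2 by (rule LIMSEQ_imp_Suc)
  then have xc: "weakly_converges x (snd l)"
    unfolding weakly_converges_def by (blast intro: LIMSEQ_imp_Suc)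
  have "(\<lambda>n. y (Suc n) \<bullet> h) \<longlonglongrightarrow> snd l \<bullet> h" for h
    using tendsto_add[OF x1[of h] tendsto_inner[OF dz0 tendsto_const[of h]]]
    by (simp add: y_eq inner_add_left)
  then have "weakly_converges y (snd l)"
    unfolding weakly_converges_def by (blast intro: LIMSEQ_imp_Suc)
  with fpl zc xc show ?thesis using that by blast
qed

end

section \<open>Step size, recursion and initial values of the concrete iteration\<close>

lemma step_size_bound:
  fixes L \<beta> \<gamma> a :: real
  assumes "0 \<le> L" "0 < \<beta>" "0 < \<gamma>" "0 \<le> a" "\<gamma> < \<beta> / (5 + (10 + 6 / a) * \<beta> * L)"
  shows "\<gamma> / (2 * \<beta>) + 2 * (\<gamma> * L) < 1 / 5"
proof -
  have "0 \<le> 6 / a * \<beta> * L" using assms by simp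
  then have d: "5 + 10 * \<beta> * L \<le> 5 + (10 + 6 / a) * \<beta> * L" by (simp add: distrib_right)
  have p: "0 < 5 + 10 * \<beta> * L" using assms by (simp add: add_pos_nonneg)
  have "\<gamma> * (5 + (10 + 6 / a) * \<beta> * L) < \<beta>"
    using assms(5) p d by (simp add: pos_less_divide_eq)
  moreover have "\<gamma> * (5 + 10 * \<beta> * L) \<le> \<gamma> * (5 + (10 + 6 / a) * \<beta> * L)"
    using d assms(3) by (intro mult_left_mono) auto
  ultimately have "\<gamma> * (5 + 10 * \<beta> * L) < \<beta>" by linarith
  \<comment> \<open>Doubling gives \<open>10 * \<gamma>\<close>, which is weakened to
    \<open>5 * \<gamma>\<close>; division by \<open>10 * \<beta>\<close> then yields the
    claim.\<close>
  then have "5 * \<gamma> + 20 * (\<beta> * (\<gamma> * L)) < 2 * \<beta>" using assms(3) by (simp add: algebra_simps)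
  then show ?thesis using assms(2) by (simp add: field_simps)
qed

theorem theorem3p2:
  fixes A1 A2 :: "'a::{real_inner, complete_space} \<Rightarrow> 'a set"
    and B C :: "'a \<Rightarrow> 'a"
    and L \<beta> \<gamma> a :: real
    and x y z :: "nat \<Rightarrow> 'a" and ym1 :: 'a
  assumes A1: "maximal_monotone A1" and A2: "maximal_monotone A2"
    and Bmono: "monotone_fun B" and Lpos: "L > 0" and Blip: "L-lipschitz_on UNIV B"
    and bpos: "\<beta> > 0" and Ccoco: "cocoercive \<beta> C"
    and zer_ne: "zer4 A1 A2 B C \<noteq> {}"
    and a_def: "a = (17 * \<beta> * L + 10 + sqrt ((17 * \<beta> * L + 10)\<^sup>2 + 144 * \<beta>\<^sup>2 * L\<^sup>2)) / (6 * \<beta> * L)"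
    and gpos: "0 < \<gamma>" and gbound: "\<gamma> < \<beta> / (5 + (10 + 6 / a) * \<beta> * L)"
    and xrec: "\<And>n. x (Suc n) = resolvent \<gamma> A1 (z n)"
    and yrec: "\<And>n. y (Suc n) = resolvent \<gamma> A2
                 (2 *\<^sub>R x (Suc n) - z n
                  - \<gamma> *\<^sub>R B (2 *\<^sub>R y n - (if n = 0 then ym1 else y (n - 1)))
                  - \<gamma> *\<^sub>R C (y n))"
    and zrec: "\<And>n. z (Suc n) = z n + y (Suc n) - x (Suc n)"
  shows "\<exists>zbar xbar. weakly_converges z zbar \<and> weakly_converges x xbar \<and> weakly_converges y xbar
           \<and> xbar = resolvent \<gamma> A1 zbar \<and> xbar \<in> zer4 A1 A2 B C"
proof -
  have "0 \<le> a" unfolding a_def using bpos Lpos by (intro divide_nonneg_nonneg add_nonneg_nonneg) auto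
  then have step: "\<gamma> / (2 * \<beta>) + 2 * (\<gamma> * L) < 1 / 5"
    by (intro step_size_bound[OF _ bpos gpos _ gbound]) (use Lpos in auto)
  interpret splitting_iteration A1 A2 B C L \<beta> \<gamma> x y z
  proof
    show "(1 / \<gamma>) *\<^sub>R (z n - x (Suc n)) \<in> A1 (x (Suc n))" for n
      unfolding xrec by (rule resolvent_mem[OF A1 gpos])
    show "(1 / \<gamma>) *\<^sub>R (2 *\<^sub>R x (Suc (Suc n)) - z (Suc n) - y (Suc (Suc n)))
        - (B (2 *\<^sub>R y (Suc n) - y n) + C (y (Suc n))) \<in> A2 (y (Suc (Suc n)))" for n
    proof -
      define t where "t = 2 *\<^sub>R x (Suc (Suc n)) - z (Suc n)
        - \<gamma> *\<^sub>R B (2 *\<^sub>R y (Suc n) - y n) - \<gamma> *\<^sub>R C (y (Suc n))"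
      \<comment> \<open>At \<open>Suc n\<close> the conditional in \<open>yrec\<close> selects
        \<open>y n\<close>, so \<open>ym1\<close> disappears.\<close>
      have y: "y (Suc (Suc n)) = resolvent \<gamma> A2 t" using yrec[of "Suc n"] by (simp add: t_def)
      have "(1 / \<gamma>) *\<^sub>R (t - y (Suc (Suc n))) \<in> A2 (y (Suc (Suc n)))"
        unfolding y by (rule resolvent_mem[OF A2 gpos])
      moreover have "(1 / \<gamma>) *\<^sub>R (t - y (Suc (Suc n)))
        = (1 / \<gamma>) *\<^sub>R (2 *\<^sub>R x (Suc (Suc n)) - z (Suc n) - y (Suc (Suc n)))
          - (B (2 *\<^sub>R y (Suc n) - y n) + C (y (Suc n)))"
        using gpos by (simp add: t_def scaleR_diff_right)
      ultimately show ?thesis by simp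
    qed
    show "norm (B u - B v) \<le> L * norm (u - v)" for u v
      using lipschitz_onD[OF Blip, of u v] by (simp add: dist_norm)
  qed (use A1 A2 Bmono Lpos bpos Ccoco gpos step zrec in \<open>auto simp: monotone_fun_def cocoercive_def\<close>)
  obtain p u1 u2 where u: "u1 \<in> A1 p" "u2 \<in> A2 p" "u1 + u2 + B p + C p = 0"
    using zer_ne by (auto simp: zer4_def)
  have "u2 = - u1 - (B p + C p)" using u(3) by (simp add: algebra_simps eq_neg_iff_add_eq_0)
  \<comment> \<open>A zero of the sum yields a stationary pair by moving \<open>p\<close> along
    \<open>u1\<close>, as in the definition of the resolvent of \<open>A1\<close>.\<close>
  then have "fixed_pair p (p + \<gamma> *\<^sub>R u1)" using u gpos by (simp add: fixed_pair_def)
  then show ?thesis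
    using weak_convergence fixed_pair_resolvent fixed_pair_zer4 by metis
qed

end
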